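(* Let $1\le p\le\infty$ and $\lambda\ge1$. The class of separable infinite-dimensional $\mathcal L_{p,\lambda+}$-spaces, i.e. the set $\{\mu\in\mathcal P: X_\mu\text{ is an infinite-dimensional }\mathcal L_{p,\lambda+}\text{-space}\}$, is a $G_\delta$-set in $\mathcal P$. In particular, it is a $G_\delta$-set in $\mathcal P_\infty$.
   Context: All Banach spaces are real. Let $V$ be the vector space over $\mathbb Q$ of all finitely supported sequences of rational numbers. $\mathcal P$ denotes the space of all pseudonorms on $V$, a closed subset of $\mathbb R^V$ with the inherited (Polish) topology of pointwise convergence. Each $\mu\in\mathcal P$ is identified with its unique extension to a pseudonorm on the real vector space $c_{00}$ of finitely supported real sequences, and $X_\mu$ denotes the completion of the quotient of $(c_{00},\mu)$ by $\{x\in c_{00}:\mu(x)=0\}$. $\mathcal P_\infty$ is the set of $\mu\in\mathcal P$ for which $X_\mu$ is infinite-dimensional, with the subspace topology. A Banach space $X$ is an $\mathcal L_{p,\lambda}$-space ($1\le p\le\infty$, $\lambda\ge1$) if every finite-dimensional subspace of $X$ is contained in another finite-dimensional subspace of $X$ whose Banach–Mazur distance to the space $\ell_p^n$ of the same dimension $n$ is at most $\lambda$. $X$ is an $\mathcal L_{p,\lambda+}$-space if it is an $\mathcal L_{p,\lambda'}$-space for every $\lambda'>\lambda$. Banach–Mazur distance: $\inf\|T\|\|T^{-1}\|$ over surjective isomorphisms $T$. *)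

theory Defs
  imports "HOL-Analysis.Analysis" "HOL-Analysis.Finite_Function_Topology"
    "HOL-Probability.Discrete_Topology"
begin

section \<open>The space of pseudonorms\<close>

type_synonym V = "nat \<Rightarrow>\<^sub>0 rat"
type_synonym c00 = "nat \<Rightarrow>\<^sub>0 real"

text \<open>Multiplication by scalars on \<open>V\<close>; on \<open>c00\<close> the library provides \<open>scaleR\<close>. The
  library's norm on \<open>c00\<close> (the sum norm) plays no role in what follows.\<close>

definition qscale :: "rat \<Rightarrow> V \<Rightarrow> V"
  where "qscale q v = Poly_Mapping.map (\<lambda>a. q * a) v"

text \<open>Nonnegativity and \<open>\<mu> 0 = 0\<close> follow from the two conditions. The function space
  \<^typ>\<open>V \<Rightarrow> real\<close> carries the product topology, i.e. that of pointwise convergence.\<close>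

definition pseudonorms :: "(V \<Rightarrow> real) set"
  where "pseudonorms =
    {\<mu>. (\<forall>u v. \<mu> (u + v) \<le> \<mu> u + \<mu> v) \<and>
        (\<forall>q v. \<mu> (qscale q v) = \<bar>of_rat q\<bar> * \<mu> v)}"

definition pseudonorm :: "('a::real_vector \<Rightarrow> real) \<Rightarrow> bool"
  where "pseudonorm \<nu> \<longleftrightarrow>
    (\<forall>x y. \<nu> (x + y) \<le> \<nu> x + \<nu> y) \<and> (\<forall>c x. \<nu> (c *\<^sub>R x) = \<bar>c\<bar> * \<nu> x)"

definition V_to_c00 :: "V \<Rightarrow> c00"
  where "V_to_c00 v = Poly_Mapping.map of_rat v"

text \<open>Existence and uniqueness are proved in \<open>pseudonorm_extension\<close> below.\<close>

definition extension :: "(V \<Rightarrow> real) \<Rightarrow> c00 \<Rightarrow> real"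
  where "extension \<mu> = (THE \<nu>. pseudonorm \<nu> \<and> (\<forall>v. \<nu> (V_to_c00 v) = \<mu> v))"


section \<open>The Banach space of a pseudonorm\<close>

instance bcontfun :: (metric_space, banach) banach ..

text \<open>Bounded real sequences with the supremum norm; continuity is no restriction on a discrete
  domain.\<close>

type_synonym linfinity = "nat discrete \<Rightarrow>\<^sub>C real"

text \<open>A linear map \<open>T\<close> with \<open>norm (T x) = \<nu> x\<close> is the same thing as a linear isometric embedding
  of the quotient by \<open>{x. \<nu> x = 0}\<close>; so this says that \<open>X\<close>, a closed subspace of a Banach space,
  is a completion of that quotient.\<close>

definition is_completion :: "('a::real_vector \<Rightarrow> real) \<Rightarrow> 'b::banach set \<Rightarrow> bool"
  where "is_completion \<nu> X \<longleftrightarrow>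
    (\<exists>T. linear T \<and> (\<forall>x. norm (T x) = \<nu> x) \<and> X = closure (range T))"

text \<open>A completion is determined up to linear isometry, and everything below is invariant under
  linear isometries. As \<open>linfinity\<close> contains an isometric copy of every separable Banach space,
  the completion can be taken inside it; see \<open>is_completion_X_space\<close> below.\<close>

definition X_space :: "(V \<Rightarrow> real) \<Rightarrow> linfinity set"
  where "X_space \<mu> = (SOME X. is_completion (extension \<mu>) X)"


section \<open>Banach--Mazur distance and script-L-p spaces\<close>

definition finite_dim :: "'a::real_vector set \<Rightarrow> bool"
  where "finite_dim E \<longleftrightarrow> (\<exists>B. finite B \<and> E \<subseteq> span B)"

text \<open>A normed space is given by a subspace \<open>E\<close> together with a function \<open>\<nu>\<close> that is a norm
  on \<open>E\<close>. The values in \<^typ>\<open>ereal\<close> make unbounded operators have norm \<open>\<infinity>\<close>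
  and non-isomorphic spaces have distance \<open>\<infinity>\<close>.\<close>

definition op_norm :: "'a::real_vector set \<Rightarrow> ('a \<Rightarrow> real) \<Rightarrow> ('b \<Rightarrow> real) \<Rightarrow> ('a \<Rightarrow> 'b) \<Rightarrow> ereal"
  where "op_norm E \<nu> \<eta> T = (SUP x\<in>{x\<in>E. \<nu> x \<le> 1}. ereal (\<eta> (T x)))"

text \<open>Only the restriction of \<open>T\<close> to \<open>E\<close> matters; every linear map on a subspace
  extends to a linear map on the whole space.\<close>

definition banach_mazur ::
    "'a::real_vector set \<Rightarrow> ('a \<Rightarrow> real) \<Rightarrow> 'b::real_vector set \<Rightarrow> ('b \<Rightarrow> real) \<Rightarrow> ereal"
  where "banach_mazur E \<nu> F \<eta> =
    Inf {op_norm E \<nu> \<eta> T * op_norm F \<eta> \<nu> (inv_into E T) | T. linear T \<and> bij_betw T E F}"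

text \<open>The space \<open>\<ell>\<^sub>p\<^sup>n\<close>, with underlying vector space the sequences supported in \<open>{..<n}\<close>.\<close>

definition lp_space :: "nat \<Rightarrow> c00 set"
  where "lp_space n = {a. Poly_Mapping.keys a \<subseteq> {..<n}}"

definition lp_norm :: "ereal \<Rightarrow> c00 \<Rightarrow> real"
  where "lp_norm p a =
    (if p = \<infinity> then (SUP i. \<bar>Poly_Mapping.lookup a i\<bar>)
     else (\<Sum>i\<in>Poly_Mapping.keys a. \<bar>Poly_Mapping.lookup a i\<bar> powr real_of_ereal p)
            powr (1 / real_of_ereal p))"

definition script_L :: "ereal \<Rightarrow> real \<Rightarrow> 'a::real_normed_vector set \<Rightarrow> bool"
  where "script_L p lam X \<longleftrightarrow>
    (\<forall>E. subspace E \<and> finite_dim E \<and> E \<subseteq> X \<longrightarrow>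
      (\<exists>F. subspace F \<and> finite_dim F \<and> E \<subseteq> F \<and> F \<subseteq> X \<and>
           banach_mazur F norm (lp_space (dim F)) (lp_norm p) \<le> ereal lam))"

definition script_L_plus :: "ereal \<Rightarrow> real \<Rightarrow> 'a::real_normed_vector set \<Rightarrow> bool"
  where "script_L_plus p lam X \<longleftrightarrow> (\<forall>lam'>lam. script_L p lam' X)"

definition pseudonorms_inf :: "(V \<Rightarrow> real) set"
  where "pseudonorms_inf = {\<mu> \<in> pseudonorms. \<not> finite_dim (X_space \<mu>)}"


section \<open>The extension to \<open>c00\<close> exists and is unique\<close>

lemma lookup_qscale [simp]: "Poly_Mapping.lookup (qscale q v) i = q * Poly_Mapping.lookup v i"
  by (simp add: qscale_def Poly_Mapping.map.rep_eq when_def)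

lemma lookup_V_to_c00 [simp]:
  "Poly_Mapping.lookup (V_to_c00 v) i = of_rat (Poly_Mapping.lookup v i)"
  by (simp add: V_to_c00_def Poly_Mapping.map.rep_eq when_def)

lemma lookup_scaleR_c00 [simp]:
  "Poly_Mapping.lookup (c *\<^sub>R x) i = c * Poly_Mapping.lookup (x::c00) i"
proof -
  have "finite {i. c *\<^sub>R Poly_Mapping.lookup x i \<noteq> 0}"
    by (rule finite_subset[OF _ finite_lookup[of x]]) auto
  then show ?thesis by (simp add: scaleR_poly_mapping_def)
qed

lemma sum_singles:
  fixes x :: "nat \<Rightarrow>\<^sub>0 'a::comm_monoid_add"
  assumes "finite K" "Poly_Mapping.keys x \<subseteq> K"
  shows "x = (\<Sum>i\<in>K. Poly_Mapping.single i (Poly_Mapping.lookup x i))"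
proof (rule poly_mapping_eqI)
  fix k
  have "(\<Sum>i\<in>K. Poly_Mapping.lookup (Poly_Mapping.single i (Poly_Mapping.lookup x i)) k)
      = (\<Sum>i\<in>K. if i = k then Poly_Mapping.lookup x k else 0)"
    by (intro sum.cong) (auto simp: lookup_single when_def)
  then show "Poly_Mapping.lookup x k =
      Poly_Mapping.lookup (\<Sum>i\<in>K. Poly_Mapping.single i (Poly_Mapping.lookup x i)) k"
    using assms by (auto simp: lookup_sum in_keys_iff)
qed

lemma subadditive_sum:
  fixes \<nu> :: "'a::comm_monoid_add \<Rightarrow> real"
  assumes "\<And>x y. \<nu> (x + y) \<le> \<nu> x + \<nu> y" "\<nu> 0 = 0"
  shows "\<nu> (sum f K) \<le> (\<Sum>i\<in>K. \<nu> (f i))"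
proof (induction K rule: infinite_finite_induct)
  case (insert i K)
  then show ?case using assms(1)[of "f i" "sum f K"] by simp
qed (simp_all add: assms)

lemma pseudonormD:
  assumes "pseudonorm \<nu>"
  shows "\<nu> (x + y) \<le> \<nu> x + \<nu> y" "\<nu> (c *\<^sub>R x) = \<bar>c\<bar> * \<nu> x" "\<nu> 0 = 0" "\<nu> (- x) = \<nu> x"
    "\<bar>\<nu> x - \<nu> y\<bar> \<le> \<nu> (x - y)" "0 \<le> \<nu> x"
proof -
  have add: "\<nu> (x + y) \<le> \<nu> x + \<nu> y" for x y using assms by (simp add: pseudonorm_def)
  have sc: "\<nu> (c *\<^sub>R x) = \<bar>c\<bar> * \<nu> x" for c x using assms by (simp add: pseudonorm_def)
  show "\<nu> (x + y) \<le> \<nu> x + \<nu> y" "\<nu> (c *\<^sub>R x) = \<bar>c\<bar> * \<nu> x" by (fact add, fact sc)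
  show z: "\<nu> 0 = 0" using sc[of 0 0] by simp
  have m: "\<nu> (- x) = \<nu> x" for x using sc[of "-1" x] by simp
  show "\<nu> (- x) = \<nu> x" by (fact m)
  show "\<bar>\<nu> x - \<nu> y\<bar> \<le> \<nu> (x - y)"
    using add[of "x - y" y] add[of "y - x" x] m[of "x - y"] by simp
  show "0 \<le> \<nu> x" using add[of x "- x"] z m[of x] by simp
qed

lemma pseudonormsD:
  assumes "\<mu> \<in> pseudonorms"
  shows "\<mu> (u + v) \<le> \<mu> u + \<mu> v" "\<mu> (qscale q u) = \<bar>of_rat q\<bar> * \<mu> u" "\<mu> 0 = 0"
    "\<bar>\<mu> u - \<mu> v\<bar> \<le> \<mu> (u - v)"
proof -
  have add: "\<mu> (u + v) \<le> \<mu> u + \<mu> v" for u v using assms by (simp add: pseudonorms_def)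
  have sc: "\<mu> (qscale q u) = \<bar>of_rat q\<bar> * \<mu> u" for q u
    using assms by (simp add: pseudonorms_def)
  show "\<mu> (u + v) \<le> \<mu> u + \<mu> v" "\<mu> (qscale q u) = \<bar>of_rat q\<bar> * \<mu> u" by (fact add, fact sc)
  have "qscale 0 0 = 0" by (rule poly_mapping_eqI) simp
  then show "\<mu> 0 = 0" using sc[of 0 0] by simp
  have "qscale (-1) (u - v) = v - u" by (rule poly_mapping_eqI) (simp add: lookup_minus)
  then have "\<mu> (v - u) = \<mu> (u - v)" using sc[of "-1" "u - v"] by simp
  then show "\<bar>\<mu> u - \<mu> v\<bar> \<le> \<mu> (u - v)"
    using add[of "u - v" v] add[of "v - u" u] by simp
qed

lemma pseudonorms_bound:
  assumes "\<mu> \<in> pseudonorms" "finite K" "Poly_Mapping.keys u \<subseteq> K" "Poly_Mapping.keys v \<subseteq> K"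
  shows "\<bar>\<mu> u - \<mu> v\<bar> \<le> (\<Sum>i\<in>K. \<bar>of_rat (Poly_Mapping.lookup u i) - of_rat (Poly_Mapping.lookup v i)\<bar>
                              * \<mu> (Poly_Mapping.single i 1))"
proof -
  let ?w = "u - v"
  have K: "Poly_Mapping.keys ?w \<subseteq> K" using assms(3,4) keys_diff[of u v] by blast
  have "\<mu> ?w = \<mu> (\<Sum>i\<in>K. Poly_Mapping.single i (Poly_Mapping.lookup ?w i))"
    using sum_singles[OF assms(2) K] by simp
  also have "\<dots> \<le> (\<Sum>i\<in>K. \<mu> (Poly_Mapping.single i (Poly_Mapping.lookup ?w i)))"
    by (intro subadditive_sum pseudonormsD assms)
  also have "\<dots> = (\<Sum>i\<in>K. \<bar>of_rat (Poly_Mapping.lookup u i) - of_rat (Poly_Mapping.lookup v i)\<bar>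
                              * \<mu> (Poly_Mapping.single i 1))"
  proof (rule sum.cong)
    fix i
    have "Poly_Mapping.single i (Poly_Mapping.lookup ?w i)
        = qscale (Poly_Mapping.lookup ?w i) (Poly_Mapping.single i 1)"
      by (rule poly_mapping_eqI) (simp add: lookup_single when_def)
    then show "\<mu> (Poly_Mapping.single i (Poly_Mapping.lookup ?w i))
        = \<bar>of_rat (Poly_Mapping.lookup u i) - of_rat (Poly_Mapping.lookup v i)\<bar>
            * \<mu> (Poly_Mapping.single i 1)"
      by (simp add: pseudonormsD[OF assms(1)] lookup_minus of_rat_diff)
  qed simp
  finally show ?thesis using pseudonormsD(4)[OF assms(1), of u v] by simp
qed

lemma pseudonorm_bound:
  fixes \<nu> :: "c00 \<Rightarrow> real"
  assumes "pseudonorm \<nu>" "finite K" "Poly_Mapping.keys x \<subseteq> K" "Poly_Mapping.keys y \<subseteq> K"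
  shows "\<bar>\<nu> x - \<nu> y\<bar> \<le> (\<Sum>i\<in>K. \<bar>Poly_Mapping.lookup x i - Poly_Mapping.lookup y i\<bar>
                              * \<nu> (Poly_Mapping.single i 1))"
proof -
  let ?w = "x - y"
  have K: "Poly_Mapping.keys ?w \<subseteq> K" using assms(3,4) keys_diff[of x y] by blast
  have "\<nu> ?w = \<nu> (\<Sum>i\<in>K. Poly_Mapping.single i (Poly_Mapping.lookup ?w i))"
    using sum_singles[OF assms(2) K] by simp
  also have "\<dots> \<le> (\<Sum>i\<in>K. \<nu> (Poly_Mapping.single i (Poly_Mapping.lookup ?w i)))"
    by (intro subadditive_sum pseudonormD(1,3) assms)
  also have "\<dots> = (\<Sum>i\<in>K. \<bar>Poly_Mapping.lookup x i - Poly_Mapping.lookup y i\<bar>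
                              * \<nu> (Poly_Mapping.single i 1))"
  proof (rule sum.cong)
    fix i
    have "Poly_Mapping.single i (Poly_Mapping.lookup ?w i)
        = (Poly_Mapping.lookup ?w i) *\<^sub>R (Poly_Mapping.single i 1)"
      by (rule poly_mapping_eqI) (simp add: lookup_single when_def)
    then show "\<nu> (Poly_Mapping.single i (Poly_Mapping.lookup ?w i))
        = \<bar>Poly_Mapping.lookup x i - Poly_Mapping.lookup y i\<bar> * \<nu> (Poly_Mapping.single i 1)"
      by (simp add: pseudonormD(2)[OF assms(1)] lookup_minus)
  qed simp
  finally show ?thesis using pseudonormD(5)[OF assms(1), of x y] by simp
qed

definition rat_approx :: "nat \<Rightarrow> real \<Rightarrow> rat"
  where "rat_approx n a = of_int \<lfloor>of_nat (Suc n) * a\<rfloor> / of_nat (Suc n)"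

definition V_approx :: "nat \<Rightarrow> c00 \<Rightarrow> V"
  where "V_approx n x = Poly_Mapping.map (rat_approx n) x"

lemma lookup_V_approx [simp]:
  "Poly_Mapping.lookup (V_approx n x) i = rat_approx n (Poly_Mapping.lookup x i)"
  by (simp add: V_approx_def Poly_Mapping.map.rep_eq when_def rat_approx_def)

lemma keys_V_approx: "Poly_Mapping.keys (V_approx n x) \<subseteq> Poly_Mapping.keys x"
  by (auto simp: in_keys_iff rat_approx_def)

lemma rat_approx_tendsto: "(\<lambda>n. of_rat (rat_approx n a) :: real) \<longlonglongrightarrow> a"
proof (rule LIMSEQ_I)
  fix r :: real assume "0 < r"
  then obtain N where N: "inverse (real (Suc N)) < r" using reals_Archimedean by blast
  have "norm (of_rat (rat_approx n a) - a) < r" if "N \<le> n" for n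
  proof -
    have s: "0 < real (Suc n)" by simp
    have eq: "of_rat (rat_approx n a) = real_of_int \<lfloor>real (Suc n) * a\<rfloor> / real (Suc n)"
      by (simp add: rat_approx_def of_rat_divide flip: of_nat_Suc)
    have "\<bar>real_of_int \<lfloor>real (Suc n) * a\<rfloor> - real (Suc n) * a\<bar> \<le> 1" by linarith
    moreover have "real_of_int \<lfloor>real (Suc n) * a\<rfloor> - real (Suc n) * a
        = (of_rat (rat_approx n a) - a) * real (Suc n)"
      using s by (simp add: eq left_diff_distrib del: of_nat_Suc)
    ultimately have "\<bar>of_rat (rat_approx n a) - a\<bar> * real (Suc n) \<le> 1"
      using s by (simp add: abs_mult del: of_nat_Suc)
    then have "\<bar>of_rat (rat_approx n a) - a\<bar> \<le> inverse (real (Suc n))"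
      using s by (simp add: field_simps del: of_nat_Suc)
    also have "\<dots> \<le> inverse (real (Suc N))" using that by (simp add: field_simps)
    finally show ?thesis using N by simp
  qed
  then show "\<exists>N. \<forall>n\<ge>N. norm (of_rat (rat_approx n a) - a) < r" by blast
qed

lemma extension_unique:
  assumes "pseudonorm \<nu>"
  shows "(\<lambda>n. \<nu> (V_to_c00 (V_approx n x))) \<longlonglongrightarrow> \<nu> x"
proof -
  let ?K = "Poly_Mapping.keys x"
  have k: "Poly_Mapping.keys (V_to_c00 (V_approx n x)) \<subseteq> ?K" for n
    by (auto simp: in_keys_iff rat_approx_def)
  have "(\<lambda>n. \<nu> (V_to_c00 (V_approx n x)) - \<nu> x) \<longlonglongrightarrow> 0"
  proof (rule Lim_null_comparison)
    show "\<forall>\<^sub>F n in sequentially. norm (\<nu> (V_to_c00 (V_approx n x)) - \<nu> x) \<le>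
      (\<Sum>i\<in>?K. \<bar>of_rat (rat_approx n (Poly_Mapping.lookup x i)) - Poly_Mapping.lookup x i\<bar>
         * \<nu> (Poly_Mapping.single i 1))"
      using pseudonorm_bound[OF assms _ k order_refl] by simp
    have "(\<lambda>n. \<Sum>i\<in>?K. \<bar>of_rat (rat_approx n (Poly_Mapping.lookup x i)) - Poly_Mapping.lookup x i\<bar>
         * \<nu> (Poly_Mapping.single i 1)) \<longlonglongrightarrow>
      (\<Sum>i\<in>?K. \<bar>Poly_Mapping.lookup x i - Poly_Mapping.lookup x i\<bar> * \<nu> (Poly_Mapping.single i 1))"
      by (intro tendsto_intros rat_approx_tendsto)
    then show "(\<lambda>n. \<Sum>i\<in>?K. \<bar>of_rat (rat_approx n (Poly_Mapping.lookup x i)) - Poly_Mapping.lookup x i\<bar>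
         * \<nu> (Poly_Mapping.single i 1)) \<longlonglongrightarrow> 0" by simp
  qed
  then show ?thesis by (simp add: LIM_zero_iff)
qed

lemma pseudonorms_convergent:
  assumes "\<mu> \<in> pseudonorms"
  shows "convergent (\<lambda>n. \<mu> (V_approx n x))"
proof -
  let ?K = "Poly_Mapping.keys x"
  let ?M = "\<Sum>i\<in>?K. \<mu> (Poly_Mapping.single i 1)"
  let ?a = "\<lambda>n i. of_rat (rat_approx n (Poly_Mapping.lookup x i)) :: real"
  have \<mu>0: "0 \<le> \<mu> v" for v
    using pseudonormsD(4)[OF assms, of v 0] pseudonormsD(3)[OF assms] by simp
  have "Cauchy (\<lambda>n. \<mu> (V_approx n x))"
  proof (rule metric_CauchyI)
    fix e :: real assume "0 < e"
    define d where "d = e / (?M + 1)"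
    have M: "0 \<le> ?M" by (intro sum_nonneg \<mu>0)
    then have d: "0 < d" using \<open>0 < e\<close> by (simp add: d_def)
    have "\<exists>N. \<forall>m\<ge>N. \<forall>n\<ge>N. \<bar>?a m i - ?a n i\<bar> < d" for i
      using LIMSEQ_imp_Cauchy[OF rat_approx_tendsto[of "Poly_Mapping.lookup x i"]] d
      by (auto simp: Cauchy_def dist_real_def)
    then obtain N where N: "\<And>i m n. m \<ge> N i \<Longrightarrow> n \<ge> N i \<Longrightarrow> \<bar>?a m i - ?a n i\<bar> < d"
      by metis
    have "dist (\<mu> (V_approx m x)) (\<mu> (V_approx n x)) < e"
      if "m \<ge> Max (insert 0 (N ` ?K))" "n \<ge> Max (insert 0 (N ` ?K))" for m n
    proof -
      have "\<bar>\<mu> (V_approx m x) - \<mu> (V_approx n x)\<bar> \<le> (\<Sum>i\<in>?K. \<bar>?a m i - ?a n i\<bar> * \<mu> (Poly_Mapping.single i 1))"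
        using pseudonorms_bound[OF assms _ keys_V_approx keys_V_approx, of x m n] by simp
      also have "\<dots> \<le> (\<Sum>i\<in>?K. d * \<mu> (Poly_Mapping.single i 1))"
        using that N by (intro sum_mono mult_right_mono \<mu>0) (simp add: less_imp_le)
      also have "\<dots> = d * ?M" by (simp add: sum_distrib_left)
      also have "\<dots> < e" using M \<open>0 < e\<close> by (simp add: d_def field_simps)
      finally show ?thesis by (simp add: dist_real_def)
    qed
    then show "\<exists>M. \<forall>m\<ge>M. \<forall>n\<ge>M. dist (\<mu> (V_approx m x)) (\<mu> (V_approx n x)) < e" by blast
  qed
  then show ?thesis by (simp add: Cauchy_convergent_iff)
qed

lemma pseudonorms_limit:
  assumes "\<mu> \<in> pseudonorms" "finite K" "\<And>n. Poly_Mapping.keys (u n) \<subseteq> K"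
    and lim: "\<And>i. (\<lambda>n. of_rat (Poly_Mapping.lookup (u n) i)) \<longlonglongrightarrow> Poly_Mapping.lookup x i"
  shows "(\<lambda>n. \<mu> (u n)) \<longlonglongrightarrow> lim (\<lambda>n. \<mu> (V_approx n x))"
proof -
  let ?K = "K \<union> Poly_Mapping.keys x"
  let ?S = "\<lambda>n. \<Sum>i\<in>?K. \<bar>of_rat (Poly_Mapping.lookup (u n) i) - of_rat (rat_approx n (Poly_Mapping.lookup x i))\<bar>
         * \<mu> (Poly_Mapping.single i 1)"
  have "(\<lambda>n. \<mu> (u n) - \<mu> (V_approx n x)) \<longlonglongrightarrow> 0"
  proof (rule Lim_null_comparison)
    have "\<bar>\<mu> (u n) - \<mu> (V_approx n x)\<bar> \<le> ?S n" for n
      using pseudonorms_bound[OF assms(1), of ?K "u n" "V_approx n x"] assms(2,3) keys_V_approx[of n x]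
      by (simp add: le_supI1 le_supI2)
    then show "\<forall>\<^sub>F n in sequentially. norm (\<mu> (u n) - \<mu> (V_approx n x)) \<le> ?S n" by simp
    have "?S \<longlonglongrightarrow> (\<Sum>i\<in>?K. \<bar>Poly_Mapping.lookup x i - Poly_Mapping.lookup x i\<bar> * \<mu> (Poly_Mapping.single i 1))"
      by (intro tendsto_intros rat_approx_tendsto lim)
    then show "?S \<longlonglongrightarrow> 0" by simp
  qed
  moreover have "(\<lambda>n. \<mu> (V_approx n x)) \<longlonglongrightarrow> lim (\<lambda>n. \<mu> (V_approx n x))"
    using pseudonorms_convergent[OF assms(1)] by (simp add: convergent_LIMSEQ_iff)
  ultimately show ?thesis using tendsto_add by fastforce
qed

theorem pseudonorm_extension:
  assumes "\<mu> \<in> pseudonorms"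
  shows "\<exists>!\<nu>. pseudonorm \<nu> \<and> (\<forall>v. \<nu> (V_to_c00 v) = \<mu> v)"
proof (rule ex_ex1I)
  define \<nu> where "\<nu> = (\<lambda>x. lim (\<lambda>n. \<mu> (V_approx n x)))"
  have "lim (\<lambda>n. \<mu> (V_approx n x)) = \<nu> x" for x by (simp add: \<nu>_def)
  note L = pseudonorms_limit[OF assms, unfolded this]
  have A: "(\<lambda>n. \<mu> (V_approx n x)) \<longlonglongrightarrow> \<nu> x" for x
    by (rule L[of "Poly_Mapping.keys x"]) (simp_all add: rat_approx_tendsto keys_V_approx)
  have "\<nu> (x + y) \<le> \<nu> x + \<nu> y" for x y
  proof -
    have "(\<lambda>n. \<mu> (V_approx n x + V_approx n y)) \<longlonglongrightarrow> \<nu> (x + y)"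
    proof (rule L[of "Poly_Mapping.keys x \<union> Poly_Mapping.keys y"])
      show "Poly_Mapping.keys (V_approx n x + V_approx n y) \<subseteq> Poly_Mapping.keys x \<union> Poly_Mapping.keys y" for n
        using keys_add[of "V_approx n x" "V_approx n y"] keys_V_approx[of n] by blast
      show "(\<lambda>n. of_rat (Poly_Mapping.lookup (V_approx n x + V_approx n y) i))
          \<longlonglongrightarrow> Poly_Mapping.lookup (x + y) i" for i
        by (simp add: lookup_add of_rat_add tendsto_add rat_approx_tendsto)
    qed simp
    then show ?thesis
      using tendsto_add[OF A[of x] A[of y]] pseudonormsD(1)[OF assms]
      by (meson LIMSEQ_le)
  qed
  moreover have "\<nu> (c *\<^sub>R x) = \<bar>c\<bar> * \<nu> x" for c x
  proof -
    have "(\<lambda>n. \<mu> (qscale (rat_approx n c) (V_approx n x))) \<longlonglongrightarrow> \<nu> (c *\<^sub>R x)"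
    proof (rule L[of "Poly_Mapping.keys x"])
      show "Poly_Mapping.keys (qscale (rat_approx n c) (V_approx n x)) \<subseteq> Poly_Mapping.keys x" for n
        by (auto simp: in_keys_iff rat_approx_def)
      show "(\<lambda>n. of_rat (Poly_Mapping.lookup (qscale (rat_approx n c) (V_approx n x)) i))
          \<longlonglongrightarrow> Poly_Mapping.lookup (c *\<^sub>R x) i" for i
        by (simp add: of_rat_mult tendsto_mult rat_approx_tendsto)
    qed simp
    moreover have "(\<lambda>n. \<mu> (qscale (rat_approx n c) (V_approx n x))) \<longlonglongrightarrow> \<bar>c\<bar> * \<nu> x"
      unfolding pseudonormsD(2)[OF assms]
      by (intro tendsto_intros A rat_approx_tendsto)
    ultimately show ?thesis by (rule LIMSEQ_unique)
  qed
  moreover have "\<nu> (V_to_c00 v) = \<mu> v" for v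
    using L[of "Poly_Mapping.keys v" "\<lambda>_. v" "V_to_c00 v"] by (simp add: LIMSEQ_const_iff)
  ultimately show "\<exists>\<nu>. pseudonorm \<nu> \<and> (\<forall>v. \<nu> (V_to_c00 v) = \<mu> v)"
    unfolding pseudonorm_def by blast
next
  fix \<nu> \<nu>'
  assume *: "pseudonorm \<nu> \<and> (\<forall>v. \<nu> (V_to_c00 v) = \<mu> v)"
    "pseudonorm \<nu>' \<and> (\<forall>v. \<nu>' (V_to_c00 v) = \<mu> v)"
  show "\<nu> = \<nu>'"
  proof
    fix x
    show "\<nu> x = \<nu>' x"
      using extension_unique[of \<nu> x] extension_unique[of \<nu>' x] * LIMSEQ_unique by auto
  qed
qed

lemma
  assumes "\<mu> \<in> pseudonorms"
  shows pseudonorm_ext: "pseudonorm (extension \<mu>)"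
    and extension_V_to_c00: "extension \<mu> (V_to_c00 v) = \<mu> v"
  using theI'[OF pseudonorm_extension[OF assms], folded extension_def] by auto


section \<open>The completion exists inside \<open>linfinity\<close>\<close>

text \<open>The Hahn--Banach theorem, obtained from a minimal sublinear functional.\<close>

definition sublinear :: "('a::real_vector \<Rightarrow> real) \<Rightarrow> bool"
  where "sublinear q \<longleftrightarrow> (\<forall>x y. q (x + y) \<le> q x + q y) \<and> (\<forall>c>0. \<forall>x. q (c *\<^sub>R x) \<le> c * q x) \<and> q 0 = 0"

lemma sublinearD:
  assumes "sublinear q"
  shows "q (x + y) \<le> q x + q y" "c > 0 \<Longrightarrow> q (c *\<^sub>R x) = c * q x" "q 0 = 0" "- q (- x) \<le> q x"
proof -
  have add: "q (x + y) \<le> q x + q y" for x y using assms by (simp add: sublinear_def)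
  have sc: "q (c *\<^sub>R x) \<le> c * q x" if "c > 0" for c x using assms that by (simp add: sublinear_def)
  show "q (x + y) \<le> q x + q y" by (fact add)
  show z: "q 0 = 0" using assms by (simp add: sublinear_def)
  show "- q (- x) \<le> q x" using add[of x "- x"] z by simp
  assume c: "c > 0"
  then have "q x \<le> inverse c * q (c *\<^sub>R x)" using sc[of "inverse c" "c *\<^sub>R x"] by simp
  with c have "c * q x \<le> q (c *\<^sub>R x)" by (simp add: field_simps)
  with sc[OF c] show "q (c *\<^sub>R x) = c * q x" by (simp add: antisym)
qed

lemma sublinear_reduce:
  assumes q: "sublinear q"
  obtains q' where "sublinear q'" "\<And>x. q' x \<le> q x" "q' (- y) \<le> - q y"
proof -
  define q' where "q' = (\<lambda>x. INF t\<in>{0..}. q (x + t *\<^sub>R y) - t * q y)"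
  have qt: "q (t *\<^sub>R y) = t * q y" if "t \<ge> 0" for t
    using sublinearD(2,3)[OF q] that by (cases "t = 0") auto
  have bnd: "- q (- x) \<le> q (x + t *\<^sub>R y) - t * q y" if "t \<ge> 0" for x t
    using sublinearD(1)[OF q, of "x + t *\<^sub>R y" "- x"] qt[OF that] by simp
  have bdd: "bdd_below ((\<lambda>t. q (x + t *\<^sub>R y) - t * q y) ` {0..})" for x
    using bnd by (intro bdd_belowI2[of _ "- q (- x)"]) auto
  have le: "q' x \<le> q (x + t *\<^sub>R y) - t * q y" if "t \<ge> 0" for x t
    unfolding q'_def using that by (intro cINF_lower bdd) auto
  have ge: "r \<le> q' x" if "\<And>t. t \<ge> 0 \<Longrightarrow> r \<le> q (x + t *\<^sub>R y) - t * q y" for r x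
    unfolding q'_def using that by (intro cINF_greatest) auto
  have "q' (x1 + x2) \<le> q' x1 + q' x2" for x1 x2
  proof -
    have "q' (x1 + x2) \<le> (q (x1 + t *\<^sub>R y) - t * q y) + (q (x2 + s *\<^sub>R y) - s * q y)"
      if "t \<ge> 0" "s \<ge> 0" for t s
      using le[of "t + s" "x1 + x2"] that sublinearD(1)[OF q, of "x1 + t *\<^sub>R y" "x2 + s *\<^sub>R y"]
      by (simp add: algebra_simps)
    then have "q' (x1 + x2) - (q (x1 + t *\<^sub>R y) - t * q y) \<le> q' x2" if "t \<ge> 0" for t
      using that by (intro ge) (smt (verit))
    then have "q' (x1 + x2) - q' x2 \<le> q' x1"
      by (intro ge) (smt (verit))
    then show ?thesis by simp
  qed
  moreover have "q' (c *\<^sub>R x) \<le> c * q' x" if c: "c > 0" for c x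
  proof -
    have "q' (c *\<^sub>R x) / c \<le> q' x"
    proof (rule ge)
      fix t :: real assume "t \<ge> 0"
      then have "q' (c *\<^sub>R x) \<le> q (c *\<^sub>R x + (c * t) *\<^sub>R y) - (c * t) * q y"
        using c by (intro le) simp
      also have "\<dots> = c * (q (x + t *\<^sub>R y) - t * q y)"
        using sublinearD(2)[OF q c, of "x + t *\<^sub>R y"] by (simp add: algebra_simps)
      finally show "q' (c *\<^sub>R x) / c \<le> q (x + t *\<^sub>R y) - t * q y"
        using c by (simp add: field_simps)
    qed
    then show ?thesis using c by (simp add: field_simps)
  qed
  moreover have "q' 0 = 0"
  proof (rule antisym)
    show "q' 0 \<le> 0" using le[of 0 0] sublinearD(3)[OF q] by simp
    show "0 \<le> q' 0" by (rule ge) (simp add: qt)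
  qed
  ultimately have "sublinear q'" by (simp add: sublinear_def)
  moreover have "q' x \<le> q x" for x using le[of 0 x] by simp
  moreover have "q' (- y) \<le> - q y" using le[of 1 "- y"] sublinearD(3)[OF q] by simp
  ultimately show ?thesis by (rule that)
qed

lemma sublinear_minimal:
  assumes p: "sublinear p"
  obtains m where "sublinear m" "\<And>x. m x \<le> p x"
    "\<And>q. sublinear q \<Longrightarrow> (\<And>x. q x \<le> m x) \<Longrightarrow> q = m"
proof -
  define A where "A = {q. sublinear q \<and> (\<forall>x. q x \<le> p x)}"
  define R where "R = (\<lambda>q r :: 'a \<Rightarrow> real. \<forall>x. r x \<le> q x)"
  have "\<exists>m\<in>A. \<forall>a\<in>A. R m a \<longrightarrow> a = m"
  proof (rule predicate_Zorn)
    show "partial_order_on A (relation_of R A)"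
      by (rule partial_order_on_relation_ofI) (auto simp: R_def fun_eq_iff intro: order_trans antisym)
  next
    fix C assume C: "C \<in> Chains (relation_of R A)"
    then have CA: "C \<subseteq> A" by (auto simp: Chains_def relation_of_def)
    have ch: "R q r \<or> R r q" if "q \<in> C" "r \<in> C" for q r
      using C that by (auto simp: Chains_def relation_of_def)
    show "\<exists>u\<in>A. \<forall>a\<in>C. R a u"
    proof (cases "C = {}")
      case True
      then show ?thesis using p by (auto simp: A_def)
    next
      case False
      define u where "u = (\<lambda>x. INF q\<in>C. q x)"
      have sub: "sublinear q" "q x \<le> p x" if "q \<in> C" for q x using CA that by (auto simp: A_def)
      have "- p (- x) \<le> q x" if "q \<in> C" for q x
        using sub(2)[OF that, of "- x"] sublinearD(4)[OF sub(1)[OF that], of x] by simp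
      then have bdd: "bdd_below ((\<lambda>q. q x) ` C)" for x
        by (intro bdd_belowI2[of _ "- p (- x)"]) auto
      have le: "u x \<le> q x" if "q \<in> C" for q x
        unfolding u_def using that by (intro cINF_lower bdd)
      have ge: "r \<le> u x" if "\<And>q. q \<in> C \<Longrightarrow> r \<le> q x" for r x
        unfolding u_def using that False by (intro cINF_greatest) auto
      have "u (x + y) \<le> u x + u y" for x y
      proof -
        have *: "u (x + y) \<le> q x + r y" if qr: "q \<in> C" "r \<in> C" for q r
        proof -
          have "\<exists>s\<in>C. s x \<le> q x \<and> s y \<le> r y"
            using ch[OF qr] qr by (auto simp: R_def)
          then obtain s where s: "s \<in> C" "s x \<le> q x" "s y \<le> r y" by blast
          show ?thesis
            using le[OF s(1), of "x + y"] sublinearD(1)[OF sub(1)[OF s(1)], of x y] s(2,3) by simp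
        qed
        have "u (x + y) - q x \<le> u y" if "q \<in> C" for q
          using *[OF that] by (intro ge) (simp add: algebra_simps)
        then have "u (x + y) - u y \<le> u x"
          by (intro ge) (simp add: algebra_simps)
        then show ?thesis by simp
      qed
      moreover have "u (c *\<^sub>R x) \<le> c * u x" if c: "c > 0" for c x
      proof -
        have "u (c *\<^sub>R x) / c \<le> u x"
        proof (rule ge)
          fix q assume "q \<in> C"
          then show "u (c *\<^sub>R x) / c \<le> q x"
            using le[of q "c *\<^sub>R x"] sublinearD(2)[OF sub(1) c, of q x] c by (simp add: field_simps)
        qed
        then show ?thesis using c by (simp add: field_simps)
      qed
      moreover have "u 0 = 0"
      proof -
        have "(\<lambda>q. q 0) ` C = (\<lambda>q. 0) ` C"
          by (rule image_cong) (simp_all add: sublinearD(3)[OF sub(1)])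
        also have "\<dots> = {0}" using False by auto
        finally have "(\<lambda>q. q 0) ` C = {0}" .
        then show ?thesis by (simp add: u_def)
      qed
      ultimately have "sublinear u" by (simp add: sublinear_def)
      moreover have "u x \<le> p x" for x
        using False le sub(2) by (meson ex_in_conv order_trans)
      ultimately show ?thesis using le by (auto simp: A_def R_def)
    qed
  qed
  then obtain m where m: "m \<in> A" "\<And>a. a \<in> A \<Longrightarrow> R m a \<Longrightarrow> a = m" by blast
  show ?thesis
  proof (rule that)
    show "sublinear m" "\<And>x. m x \<le> p x" using m(1) by (auto simp: A_def)
    fix q assume "sublinear q" "\<And>x. q x \<le> m x"
    then show "q = m"
      using m(1) by (intro m(2)) (auto simp: A_def R_def intro: order_trans)
  qed
qed

lemma norming_functional:
  assumes "pseudonorm \<nu>"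
  obtains f where "linear f" "\<And>x. \<bar>f x\<bar> \<le> \<nu> x" "f y = \<nu> y"
proof -
  have "sublinear \<nu>" using pseudonormD[OF assms] by (simp add: sublinear_def)
  from sublinear_reduce[OF this]
  obtain p where p: "sublinear p" "\<And>x. p x \<le> \<nu> x" "p (- y) \<le> - \<nu> y" by blast
  from sublinear_minimal[OF p(1)]
  obtain m where m: "sublinear m" "\<And>x. m x \<le> p x"
    "\<And>q. sublinear q \<Longrightarrow> (\<And>x. q x \<le> m x) \<Longrightarrow> q = m" by metis
  have neg: "m (- x) = - m x" for x
  proof -
    from sublinear_reduce[OF m(1)]
    obtain q where "sublinear q" "\<And>z. q z \<le> m z" "q (- x) \<le> - m x" by blast
    then have "m (- x) \<le> - m x" using m(3) by metis
    then show ?thesis using sublinearD(4)[OF m(1), of x] by simp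
  qed
  have add: "m (u + v) = m u + m v" for u v
    using sublinearD(1)[OF m(1), of u v] sublinearD(1)[OF m(1), of "- u" "- v"]
      neg[of "u + v"] neg[of u] neg[of v] by simp
  have "m (c *\<^sub>R x) = c *\<^sub>R m x" for c x
  proof (cases c "0::real" rule: linorder_cases)
    case less
    then have "m ((- c) *\<^sub>R x) = - c * m x" by (intro sublinearD(2)[OF m(1)]) simp
    then show ?thesis using neg[of "(- c) *\<^sub>R x"] by simp
  qed (use sublinearD[OF m(1)] in auto)
  with add have "linear m" by (rule linearI)
  moreover have le: "m x \<le> \<nu> x" for x using m(2) p(2) order_trans by blast
  have "\<bar>m x\<bar> \<le> \<nu> x" for x
    using le[of x] le[of "- x"] neg[of x] pseudonormD(4)[OF assms, of x] by simp
  moreover have "m y = \<nu> y"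
    using m(2)[of "- y"] p(3) neg[of y] le[of y] by simp
  ultimately show ?thesis by (rule that)
qed

lemma countable_V: "countable (UNIV :: V set)"
proof -
  have "(UNIV :: V set) \<subseteq> range Poly_Mapping.nth"
  proof
    fix v :: V
    obtain n where n: "\<And>k. k \<in> Poly_Mapping.keys v \<Longrightarrow> k < n"
      using finite_nat_set_iff_bounded[of "Poly_Mapping.keys v"] by auto
    have "v = Poly_Mapping.nth (map (Poly_Mapping.lookup v) [0..<n])"
    proof (rule poly_mapping_eqI)
      fix k
      show "Poly_Mapping.lookup v k = Poly_Mapping.lookup (Poly_Mapping.nth (map (Poly_Mapping.lookup v) [0..<n])) k"
        using n[of k] by (auto simp: nth.rep_eq nth_default_def in_keys_iff)
    qed
    then show "v \<in> range Poly_Mapping.nth" by blast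
  qed
  then show ?thesis by (rule countable_subset) simp
qed

theorem ex_completion:
  assumes "pseudonorm (\<nu> :: c00 \<Rightarrow> real)"
  shows "\<exists>X :: linfinity set. is_completion \<nu> X"
proof -
  define v where "v = from_nat_into (UNIV :: V set)"
  have v: "\<exists>n. v n = w" for w
    using from_nat_into_surj[OF countable_V, of w] by (simp add: v_def)
  have "\<exists>f. linear f \<and> (\<forall>x. \<bar>f x\<bar> \<le> \<nu> x) \<and> f (V_to_c00 (v n)) = \<nu> (V_to_c00 (v n))" for n
    using norming_functional[OF assms] by metis
  then obtain f where f: "\<And>n. linear (f n)" "\<And>n x. \<bar>f n x\<bar> \<le> \<nu> x"
    "\<And>n. f n (V_to_c00 (v n)) = \<nu> (V_to_c00 (v n))" by metis
  define T :: "c00 \<Rightarrow> linfinity" where "T = (\<lambda>x. Bcontfun (\<lambda>n. f (of_discrete n) x))"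
  have T: "apply_bcontfun (T x) n = f (of_discrete n) x" for x n
  proof -
    have "continuous_on UNIV (\<lambda>n :: nat discrete. f (of_discrete n) x)"
      by (simp add: continuous_on_open_vimage open_discrete)
    then have "(\<lambda>n. f (of_discrete n) x) \<in> bcontfun"
      by (rule bcontfun_normI[of _ "\<nu> x"]) (use f(2) in auto)
    then show ?thesis by (simp add: T_def Bcontfun_inverse)
  qed
  have lin: "linear T"
    by (rule linearI; rule bcontfun_eqI)
      (simp_all add: T linear_add[OF f(1)] linear_scale[OF f(1)])
  have upper: "norm (T x) \<le> \<nu> x" for x
    by (rule norm_bound) (use f(2) in \<open>simp add: T\<close>)
  have eq: "norm (T (V_to_c00 w)) = \<nu> (V_to_c00 w)" for w
  proof (rule antisym[OF upper])
    obtain n where "v n = w" using v by blast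
    then have "\<nu> (V_to_c00 w) = apply_bcontfun (T (V_to_c00 w)) (discrete n)" using f(3)[of n] by (simp add: T discrete_inverse)
    also have "\<dots> \<le> norm (T (V_to_c00 w))"
      using norm_bounded[of "T (V_to_c00 w)" "discrete n"] by simp
    finally show "\<nu> (V_to_c00 w) \<le> norm (T (V_to_c00 w))" .
  qed
  have "pseudonorm (\<lambda>x. norm (T x))"
    by (simp add: pseudonorm_def linear_add[OF lin] linear_scale[OF lin] norm_triangle_ineq)
  then have "norm (T x) = \<nu> x" for x
    using extension_unique[of "\<lambda>x. norm (T x)" x] extension_unique[OF assms, of x] eq
      LIMSEQ_unique by auto
  with lin show ?thesis unfolding is_completion_def by blast
qed

corollary is_completion_X_space:
  assumes "\<mu> \<in> pseudonorms"
  shows "is_completion (extension \<mu>) (X_space \<mu>)"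
  unfolding X_space_def using someI_ex[OF ex_completion[OF pseudonorm_ext[OF assms]]] .

end

(* The space X is an infinite-dimensional script-L_{p,lam+}-space if and only if for every m there
   are n >= m and vectors w_0, ..., w_{n-1} in c00 that span, with respect to the pseudonorm, a copy
   of l_p^n with constants strictly between 1 and lam + 1/(m+1), such that the first m unit vectors
   are within 1/(m+1) of this span. For fixed m this is an open condition on the pseudonorm, so the
   set in question is a countable intersection of open sets.

   If X is such a space, the basis of a nearly optimal copy of l_p^n that contains the first m unit
   vectors is approximated by vectors of c00. Conversely, let b range over a basis of a
   finite-dimensional subspace E. For large m each b is close to some u_b in the span of the w_i.
   With bounded functionals g_b biorthogonal to the basis, the operator I + sum_b g_b (u_b - b) is a
   small perturbation of the identity that maps b to u_b; the preimage of the span of the w_i under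
   it contains E, and its distance to l_p^n is almost unchanged. *)

theory Submission
  imports Defs
begin

section \<open>Linear combinations and the norm of \<open>\<ell>\<^sub>p\<^sup>n\<close>\<close>

text \<open>The sum norm serves below as the reference norm on \<open>c00\<close>. Any finite
  \<open>K\<close> containing the support is allowed, so that sums may run over
  \<open>{..<n}\<close>.\<close>

lemma norm_c00:
  assumes "finite K" "Poly_Mapping.keys (x::c00) \<subseteq> K"
  shows "norm x = (\<Sum>i\<in>K. \<bar>Poly_Mapping.lookup x i\<bar>)"
  unfolding norm_poly_mapping_def dist_poly_mapping_def
  using assms by (auto intro!: sum.mono_neutral_left simp: in_keys_iff)

lemma abs_lookup_le_norm: "\<bar>Poly_Mapping.lookup x i\<bar> \<le> norm (x::c00)"
proof -
  let ?K = "insert i (Poly_Mapping.keys x)"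
  have "\<bar>Poly_Mapping.lookup x i\<bar> \<le> (\<Sum>j\<in>?K. \<bar>Poly_Mapping.lookup x j\<bar>)"
    by (rule member_le_sum) auto
  also have "\<dots> = norm x" by (rule norm_c00[symmetric]) auto
  finally show ?thesis .
qed

text \<open>This is the linear map on \<open>c00\<close> that sends the \<open>i\<close>-th unit
  vector to \<open>w i\<close>. Summing over the support makes it total, so one map serves every
  \<open>n\<close>.\<close>

definition lincomb :: "(nat \<Rightarrow> 'a::real_vector) \<Rightarrow> c00 \<Rightarrow> 'a"
  where "lincomb w a = (\<Sum>i\<in>Poly_Mapping.keys a. Poly_Mapping.lookup a i *\<^sub>R w i)"

lemma lincomb_eq:
  assumes "finite K" "Poly_Mapping.keys a \<subseteq> K"
  shows "lincomb w a = (\<Sum>i\<in>K. Poly_Mapping.lookup a i *\<^sub>R w i)"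
  unfolding lincomb_def using assms by (auto intro!: sum.mono_neutral_left simp: in_keys_iff)

lemma lincomb_lp_space:
  "a \<in> lp_space n \<Longrightarrow> lincomb w a = (\<Sum>i<n. Poly_Mapping.lookup a i *\<^sub>R w i)"
  by (rule lincomb_eq) (auto simp: lp_space_def)

lemma keys_scaleR_subset: "Poly_Mapping.keys (c *\<^sub>R (a::c00)) \<subseteq> Poly_Mapping.keys a"
  by (auto simp: in_keys_iff)

lemma linear_lincomb: "linear (lincomb w)"
proof (rule linearI)
  fix a b :: c00 and c :: real
  let ?K = "Poly_Mapping.keys a \<union> Poly_Mapping.keys b"
  show "lincomb w (a + b) = lincomb w a + lincomb w b"
    using keys_add[of a b]
    by (simp add: lincomb_eq[of ?K] lookup_add scaleR_left_distrib sum.distrib)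
  show "lincomb w (c *\<^sub>R a) = c *\<^sub>R lincomb w a"
    using keys_scaleR_subset[of c a]
    by (simp add: lincomb_eq[of "Poly_Mapping.keys a"] scaleR_sum_right)
qed

lemma linear_eq_lincomb:
  assumes "linear \<Phi>"
  shows "\<Phi> (a::c00) = lincomb (\<lambda>i. \<Phi> (Poly_Mapping.single i 1)) a"
proof -
  have *: "Poly_Mapping.single i c = c *\<^sub>R Poly_Mapping.single i (1::real)" for i :: nat and c
    by (rule poly_mapping_eqI) (simp add: lookup_single when_def)
  have "\<Phi> a = \<Phi> (\<Sum>i\<in>Poly_Mapping.keys a. Poly_Mapping.lookup a i *\<^sub>R Poly_Mapping.single i 1)"
    using sum_singles[of "Poly_Mapping.keys a" a] by (simp flip: *)
  then show ?thesis by (simp add: lincomb_def linear_sum[OF assms] linear_scale[OF assms])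
qed

lemma linear_image_lincomb: "linear T \<Longrightarrow> T (lincomb w a) = lincomb (\<lambda>i. T (w i)) a"
  by (simp add: lincomb_def linear_sum linear_scale)

text \<open>In the perturbation arguments \<open>w\<close> is a family of differences; closeness of
  vectors then becomes closeness of the operators they define.\<close>

lemma norm_lincomb_le:
  assumes "\<And>i. i \<in> Poly_Mapping.keys a \<Longrightarrow> norm (w i) \<le> e"
  shows "norm (lincomb w a) \<le> e * norm a"
proof -
  have "norm (lincomb w a) \<le> (\<Sum>i\<in>Poly_Mapping.keys a. \<bar>Poly_Mapping.lookup a i\<bar> * norm (w i))"
    unfolding lincomb_def by (rule order_trans[OF norm_sum]) simp
  also have "\<dots> \<le> (\<Sum>i\<in>Poly_Mapping.keys a. \<bar>Poly_Mapping.lookup a i\<bar> * e)"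
    using assms by (intro sum_mono mult_left_mono) auto
  finally show ?thesis
    by (simp add: norm_c00[of "Poly_Mapping.keys a" a] sum_distrib_left mult.commute)
qed

section \<open>Coordinate subspaces and their dimension\<close>

lemma subspace_lp_space: "subspace (lp_space n)"
proof (rule subspaceI)
  fix x y :: c00 and c :: real
  assume "x \<in> lp_space n"
  then show "c *\<^sub>R x \<in> lp_space n" using keys_scaleR_subset[of c x] by (auto simp: lp_space_def)
  assume "y \<in> lp_space n"
  then show "x + y \<in> lp_space n"
    using \<open>x \<in> lp_space n\<close> keys_add[of x y] by (auto simp: lp_space_def)
qed (simp add: lp_space_def)

lemma single_in_lp_space: "i < n \<Longrightarrow> Poly_Mapping.single i c \<in> lp_space n"
  by (simp add: lp_space_def)

lemma lp_space_eq_span: "lp_space n = span ((\<lambda>i. Poly_Mapping.single i (1::real)) ` {..<n})"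
proof
  show "lp_space n \<subseteq> span ((\<lambda>i. Poly_Mapping.single i (1::real)) ` {..<n})"
  proof
    fix a assume a: "a \<in> lp_space n"
    have "a = (\<Sum>i<n. Poly_Mapping.lookup a i *\<^sub>R Poly_Mapping.single i 1)"
      using linear_eq_lincomb[OF linear_id, of a] lincomb_lp_space[OF a, of "\<lambda>i. Poly_Mapping.single i 1"]
      unfolding id_apply by (rule trans)
    also have "\<dots> \<in> span ((\<lambda>i. Poly_Mapping.single i (1::real)) ` {..<n})"
      by (intro span_sum span_scale span_base) auto
    finally show "a \<in> span ((\<lambda>i. Poly_Mapping.single i (1::real)) ` {..<n})" .
  qed
  show "span ((\<lambda>i. Poly_Mapping.single i (1::real)) ` {..<n}) \<subseteq> lp_space n"
    by (intro span_minimal subspace_lp_space) (auto intro: single_in_lp_space)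
qed

lemma dim_lp_space: "dim (lp_space n) = n"
proof -
  let ?e = "\<lambda>i::nat. Poly_Mapping.single i (1::real)"
  have inj: "inj_on ?e {..<n}" 
    by (rule inj_onI) (metis keys_single one_neq_zero singleton_inject)
  have "independent (?e ` {..<n})"
  proof (rule independent_if_scalars_zero)
    fix f x assume s: "(\<Sum>x\<in>?e ` {..<n}. f x *\<^sub>R x) = 0" and "x \<in> ?e ` {..<n}"
    then obtain j where j: "j < n" "x = ?e j" by auto
    have "(\<Sum>i<n. f (?e i) *\<^sub>R ?e i) = 0" using s inj by (simp add: sum.reindex)
    then have "Poly_Mapping.lookup (\<Sum>i<n. f (?e i) *\<^sub>R ?e i) j = 0" by simp
    then have "(\<Sum>i<n. if i = j then f (?e j) else 0) = 0"
      by (simp add: lookup_sum lookup_single when_def if_distrib[of "\<lambda>c. _ * c"] cong: if_cong)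
    then show "f x = 0" using j by simp
  qed simp
  then show ?thesis
    using inj by (simp add: lp_space_eq_span dim_eq_card_independent card_image)
qed

section \<open>Coordinate estimates and homogeneity of the norm\<close>

lemma lp_norm_zero [simp]: "lp_norm p 0 = 0"
  by (simp add: lp_norm_def)

lemma bdd_above_lookup: "bdd_above (range (\<lambda>i. \<bar>Poly_Mapping.lookup (a::c00) i\<bar>))"
  using abs_lookup_le_norm by (intro bdd_aboveI2) auto

text \<open>For finite \<open>p\<close>, one term of a sum of nonnegative terms is at most the sum,
  and taking roots preserves order. Positivity and the comparison with the sum norm rest on this
  bound.\<close>

lemma abs_lookup_le_lp_norm:
  assumes "1 \<le> p"
  shows "\<bar>Poly_Mapping.lookup a i\<bar> \<le> lp_norm p a"
proof (cases "p = \<infinity>")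
  case True
  then show ?thesis by (auto simp: lp_norm_def intro: cSUP_upper bdd_above_lookup)
next
  case False
  define r where "r = real_of_ereal p"
  have "p = ereal r" "1 \<le> r" using assms False by (cases p; auto simp: r_def)+
  show ?thesis
  proof (cases "i \<in> Poly_Mapping.keys a")
    case True
    have "\<bar>Poly_Mapping.lookup a i\<bar> = (\<bar>Poly_Mapping.lookup a i\<bar> powr r) powr (1 / r)"
      using \<open>1 \<le> r\<close> by (simp add: powr_powr)
    also have "\<dots> \<le> (\<Sum>j\<in>Poly_Mapping.keys a. \<bar>Poly_Mapping.lookup a j\<bar> powr r) powr (1 / r)"
      using \<open>1 \<le> r\<close> True by (intro powr_mono2 member_le_sum) auto
    finally show ?thesis using False by (simp add: lp_norm_def r_def)
  qed (simp add: lp_norm_def False in_keys_iff)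
qed

lemma lp_norm_nonneg: "1 \<le> p \<Longrightarrow> 0 \<le> lp_norm p a"
  using abs_lookup_le_lp_norm[of p a 0] by simp

lemma lp_norm_pos: "1 \<le> p \<Longrightarrow> a \<noteq> 0 \<Longrightarrow> 0 < lp_norm p a"
proof -
  assume p: "1 \<le> p" and "a \<noteq> 0"
  then obtain i where "Poly_Mapping.lookup a i \<noteq> 0" by (metis lookup_zero poly_mapping_eqI)
  then show ?thesis using abs_lookup_le_lp_norm[OF p, of a i] by linarith
qed

lemma lp_norm_scaleR:
  assumes "1 \<le> p"
  shows "lp_norm p (c *\<^sub>R a) = \<bar>c\<bar> * lp_norm p a"
\<comment> \<open>Scaling preserves the support only for nonzero \<open>c\<close>.\<close>
proof (cases "c = 0")
  case False
  then have k: "Poly_Mapping.keys (c *\<^sub>R a) = Poly_Mapping.keys a" by (auto simp: in_keys_iff)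
  show ?thesis
  proof (cases "p = \<infinity>")
    case True
    \<comment> \<open>Multiplication by a nonnegative constant is monotone and continuous, so it
      commutes with the supremum of a bounded set.\<close>
    have "(SUP i. \<bar>c\<bar> * \<bar>Poly_Mapping.lookup a i\<bar>) = \<bar>c\<bar> * (SUP i. \<bar>Poly_Mapping.lookup a i\<bar>)"
    proof -
      have "mono (\<lambda>x. \<bar>c\<bar> * x)" by (auto intro!: monoI mult_left_mono)
      moreover have "continuous (at_left (SUP i. \<bar>Poly_Mapping.lookup a i\<bar>)) (\<lambda>x. \<bar>c\<bar> * x)"
        by (intro continuous_intros)
      ultimately show ?thesis
        using continuous_at_Sup_mono[of "\<lambda>x. \<bar>c\<bar> * x" "range (\<lambda>i. \<bar>Poly_Mapping.lookup a i\<bar>)"]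
          bdd_above_lookup[of a]
        by (simp add: image_image)
    qed
    then show ?thesis using True by (simp add: lp_norm_def abs_mult)
  next
    case fin: False
    define r where "r = real_of_ereal p"
    have "p = ereal r" "1 \<le> r" using assms fin by (cases p; auto simp: r_def)+
    have "(\<Sum>j\<in>Poly_Mapping.keys a. \<bar>c * Poly_Mapping.lookup a j\<bar> powr r)
        = \<bar>c\<bar> powr r * (\<Sum>j\<in>Poly_Mapping.keys a. \<bar>Poly_Mapping.lookup a j\<bar> powr r)"
      by (simp add: abs_mult powr_mult sum_distrib_left)
    then have "(\<Sum>j\<in>Poly_Mapping.keys a. \<bar>c * Poly_Mapping.lookup a j\<bar> powr r) powr (1/r)
        = (\<bar>c\<bar> powr r) powr (1/r) * (\<Sum>j\<in>Poly_Mapping.keys a. \<bar>Poly_Mapping.lookup a j\<bar> powr r) powr (1/r)"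
      by (simp add: powr_mult sum_nonneg)
    then show ?thesis using fin k \<open>1 \<le> r\<close> by (simp add: lp_norm_def r_def powr_powr)
  qed
qed simp

text \<open>Each of the \<open>n\<close> coordinates is at most \<open>lp_norm p a\<close>. The
  crude constant is harmless, since \<open>n\<close> is fixed before any tolerance is
  chosen.\<close>

lemma norm_le_lp_norm:
  assumes "1 \<le> p" "a \<in> lp_space n"
  shows "norm a \<le> real n * lp_norm p a"
proof -
  have "norm a = (\<Sum>i<n. \<bar>Poly_Mapping.lookup a i\<bar>)"
    using assms by (intro norm_c00) (auto simp: lp_space_def)
  also have "\<dots> \<le> (\<Sum>i<n. lp_norm p a)"
    by (intro sum_mono abs_lookup_le_lp_norm assms)
  finally show ?thesis by simp
qed

section \<open>Openness\<close>

lemma rat_approx_dist: "\<bar>of_rat (rat_approx k a) - a\<bar> \<le> 1 / real (Suc k)"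
proof -
  have s: "0 < real (Suc k)" by simp
  have eq: "of_rat (rat_approx k a) = real_of_int \<lfloor>real (Suc k) * a\<rfloor> / real (Suc k)"
    by (simp add: rat_approx_def of_rat_divide flip: of_nat_Suc)
  have "\<bar>real_of_int \<lfloor>real (Suc k) * a\<rfloor> - real (Suc k) * a\<bar> \<le> 1" by linarith
  moreover have "real_of_int \<lfloor>real (Suc k) * a\<rfloor> - real (Suc k) * a
      = (of_rat (rat_approx k a) - a) * real (Suc k)"
    using s by (simp add: eq left_diff_distrib del: of_nat_Suc)
  ultimately have "\<bar>of_rat (rat_approx k a) - a\<bar> * real (Suc k) \<le> 1"
    using s by (simp add: abs_mult del: of_nat_Suc)
  then show ?thesis using s by (simp add: field_simps del: of_nat_Suc)
qed

text \<open>A vector supported in \<open>K\<close> is determined by its restriction to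
  \<open>K\<close>, and there are only finitely many functions from \<open>K\<close> to
  \<open>R\<close>.\<close>

lemma finite_V_grid:
  assumes "finite K" "finite R"
  shows "finite {v::V. Poly_Mapping.keys v \<subseteq> K \<and> (\<forall>i\<in>K. Poly_Mapping.lookup v i \<in> R)}"
    (is "finite ?G")
proof (rule inj_on_finite)
  show "inj_on (\<lambda>v. restrict (Poly_Mapping.lookup v) K) ?G"
  proof (rule inj_onI, rule poly_mapping_eqI)
    fix u v :: V and i
    assume u: "u \<in> ?G" and v: "v \<in> ?G"
      and eq: "restrict (Poly_Mapping.lookup u) K = restrict (Poly_Mapping.lookup v) K"
    show "Poly_Mapping.lookup u i = Poly_Mapping.lookup v i"
    proof (cases "i \<in> K")
      case True
      then show ?thesis using fun_cong[OF eq, of i] by simp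
    next
      case False
      then have "i \<notin> Poly_Mapping.keys u" "i \<notin> Poly_Mapping.keys v" using u v by auto
      then show ?thesis by (simp add: in_keys_iff)
    qed
  qed
  show "(\<lambda>v. restrict (Poly_Mapping.lookup v) K) ` ?G \<subseteq> PiE K (\<lambda>_. R)" by auto
  show "finite (PiE K (\<lambda>_. R))" using assms by (simp add: finite_PiE)
qed

text \<open>The coordinates of \<open>x\<close> lie between -1 and 1, so the integer numerators
  produced by rounding lie between \<open>- Suc k\<close> and \<open>Suc k\<close>.\<close>

lemma V_approx_grid:
  assumes "norm (x::c00) \<le> 1"
  shows "Poly_Mapping.lookup (V_approx k x) i
    \<in> (\<lambda>j. of_int j / of_nat (Suc k)) ` {- int (Suc k)..int (Suc k)}"
proof -
  have x: "\<bar>Poly_Mapping.lookup x i\<bar> \<le> 1" using abs_lookup_le_norm[of x i] assms by linarith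
  let ?r = "real (Suc k) * Poly_Mapping.lookup x i"
  have "\<bar>?r\<bar> \<le> real (Suc k)" using x by (simp add: abs_mult mult_left_le del: of_nat_Suc)
  then have r: "- real (Suc k) \<le> ?r" "?r \<le> real (Suc k)" by (auto simp only: abs_le_iff minus_le_iff)
  have "- int (Suc k) \<le> \<lfloor>?r\<rfloor>"
    unfolding le_floor_iff of_int_minus of_int_of_nat_eq by (rule r)
  moreover have "\<lfloor>?r\<rfloor> \<le> int (Suc k)" using floor_mono[OF r(2)] by (simp only: floor_of_nat)
  ultimately show ?thesis unfolding lookup_V_approx rat_approx_def by (intro image_eqI[OF refl]) simp
qed

text \<open>By homogeneity it suffices to control the unit ball of the finitely many coordinates in \<open>K\<close>,
  and there closeness at the points of a finite rational grid is enough, because a bound on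
  \<open>\<mu> (single i 1)\<close> is an open condition as well and gives a common Lipschitz constant.\<close>

lemma extension_close:
  assumes \<mu>0: "\<mu>0 \<in> pseudonorms" and K: "finite K" and "0 < e"
  obtains N where "open N" "\<mu>0 \<in> N"
    "\<And>\<mu> x. \<mu> \<in> N \<Longrightarrow> \<mu> \<in> pseudonorms \<Longrightarrow> Poly_Mapping.keys x \<subseteq> K \<Longrightarrow>
      \<bar>extension \<mu> x - extension \<mu>0 x\<bar> \<le> e * norm x"
proof -
  let ?e = "\<lambda>i::nat. Poly_Mapping.single i (1::rat)"
  \<comment> \<open>The summand 1 puts \<open>M\<close> strictly above every
    \<open>\<mu>0 (?e i)\<close>, so that \<open>\<mu>0\<close> itself satisfies the open bounds in
    \<open>N\<close>.\<close>
  define M where "M = 1 + (\<Sum>i\<in>K. \<bar>\<mu>0 (?e i)\<bar>)"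
  have M: "\<mu>0 (?e i) < M" if "i \<in> K" for i
    using member_le_sum[of i K "\<lambda>i. \<bar>\<mu>0 (?e i)\<bar>"] that K by (simp add: M_def)
  have "0 < M" unfolding M_def by (intro add_pos_nonneg sum_nonneg) auto
  \<comment> \<open>Rounding moves each of the \<open>card K\<close> coordinates by at most
    \<open>1 / Suc k\<close>, at cost \<open>M\<close> per unit; this \<open>k\<close> keeps the
    total below \<open>e / 4\<close>.\<close>
  obtain k where k: "4 * real (card K) * M / e < real k" using reals_Archimedean2 by blast
  have small: "real (card K) * (M / real (Suc k)) \<le> e / 4"
  proof -
    have "4 * real (card K) * M < e * real k" using k \<open>0 < e\<close> by (simp add: field_simps)
    also have "\<dots> \<le> e * real (Suc k)" using \<open>0 < e\<close> by (intro mult_left_mono) auto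
    finally show ?thesis by (simp add: field_simps)
  qed
  define G where "G = {v::V. Poly_Mapping.keys v \<subseteq> K \<and>
      (\<forall>i\<in>K. Poly_Mapping.lookup v i \<in> (\<lambda>j. of_int j / of_nat (Suc k)) ` {- int (Suc k)..int (Suc k)})}"
  have G: "finite G" unfolding G_def using K by (intro finite_V_grid) auto
  \<comment> \<open>Finitely many evaluations are restricted by strict inequalities, which is open
    for pointwise convergence.\<close>
  define N where "N = (\<Inter>i\<in>K. {\<mu>. \<mu> (?e i) < M}) \<inter> (\<Inter>v\<in>G. {\<mu>. \<bar>\<mu> v - \<mu>0 v\<bar> < e / 2})"
  have "open N" unfolding N_def
    by (intro open_Int open_INT ballI K G open_Collect_less continuous_intros continuous_on_product_coordinates)
  moreover have "\<mu>0 \<in> N" using M \<open>0 < e\<close> by (simp add: N_def)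
  moreover have "\<bar>extension \<mu> x - extension \<mu>0 x\<bar> \<le> e * norm x"
    if \<mu>: "\<mu> \<in> N" "\<mu> \<in> pseudonorms" and x: "Poly_Mapping.keys x \<subseteq> K" for \<mu> x
  proof -
    have near: "\<bar>extension \<nu> y - \<nu> (V_approx k y)\<bar> \<le> e / 4"
      if \<nu>: "\<nu> \<in> N" "\<nu> \<in> pseudonorms" and y: "Poly_Mapping.keys y \<subseteq> K" for \<nu> y
    proof -
      let ?z = "V_to_c00 (V_approx k y)"
      have z: "Poly_Mapping.keys ?z \<subseteq> K"
        using keys_V_approx[of k y] y by (auto simp: in_keys_iff rat_approx_def)
      have e: "Poly_Mapping.single i 1 = V_to_c00 (?e i)" for i
        by (rule poly_mapping_eqI) (simp add: lookup_single when_def)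
      have "\<bar>extension \<nu> y - extension \<nu> ?z\<bar>
          \<le> (\<Sum>i\<in>K. \<bar>Poly_Mapping.lookup y i - Poly_Mapping.lookup ?z i\<bar> * extension \<nu> (Poly_Mapping.single i 1))"
        by (rule pseudonorm_bound[OF pseudonorm_ext[OF \<nu>(2)] K y z])
      also have "\<dots> \<le> (\<Sum>i\<in>K. 1 / real (Suc k) * M)"
      proof (rule sum_mono, rule mult_mono)
        fix i assume "i \<in> K"
        then show "extension \<nu> (Poly_Mapping.single i 1) \<le> M"
          using \<nu>(1) unfolding e extension_V_to_c00[OF \<nu>(2)] by (auto simp: N_def)
        show "\<bar>Poly_Mapping.lookup y i - Poly_Mapping.lookup ?z i\<bar> \<le> 1 / real (Suc k)"
          using rat_approx_dist[of k "Poly_Mapping.lookup y i"] by (simp add: abs_minus_commute)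
        show "0 \<le> extension \<nu> (Poly_Mapping.single i 1)"
          by (rule pseudonormD(6)[OF pseudonorm_ext[OF \<nu>(2)]])
      qed simp
      also have "\<dots> \<le> e / 4" using small by simp
      finally show ?thesis by (simp add: extension_V_to_c00[OF \<nu>(2)])
    qed
    \<comment> \<open>Rounding costs \<open>e / 4\<close> for each of the two pseudonorms, and their
      difference at the common grid point costs \<open>e / 2\<close>.\<close>
    have unit: "\<bar>extension \<mu> y - extension \<mu>0 y\<bar> \<le> e"
      if y: "Poly_Mapping.keys y \<subseteq> K" "norm y \<le> 1" for y
    proof -
      have "V_approx k y \<in> G"
        using V_approx_grid[OF y(2), of k] keys_V_approx[of k y] y(1) unfolding G_def by blast
      then have "\<bar>\<mu> (V_approx k y) - \<mu>0 (V_approx k y)\<bar> < e / 2" using \<mu>(1) by (auto simp: N_def)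
      then show ?thesis
        using near[OF \<mu> y(1)] near[OF \<open>\<mu>0 \<in> N\<close> \<mu>0 y(1)] by linarith
    qed
    show ?thesis
    proof (cases "x = 0")
      case True
      then show ?thesis
        using pseudonormD(3)[OF pseudonorm_ext[OF \<mu>(2)]] pseudonormD(3)[OF pseudonorm_ext[OF \<mu>0]] by simp
    next
      case False
      define y where "y = x /\<^sub>R norm x"
      have xy: "x = norm x *\<^sub>R y" using False by (simp add: y_def)
      have "\<bar>extension \<mu> y - extension \<mu>0 y\<bar> \<le> e"
        using x False keys_scaleR_subset[of "inverse (norm x)" x]
        by (intro unit) (auto simp: y_def)
      moreover have "extension \<nu> x = norm x * extension \<nu> y" if "\<nu> \<in> pseudonorms" for \<nu>
        using arg_cong[OF xy, of "extension \<nu>"] pseudonormD(2)[OF pseudonorm_ext[OF that], of "norm x" y]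
        by simp
      note this[OF \<mu>(2)] this[OF \<mu>0]
      ultimately show ?thesis using False
        by (simp add: abs_mult mult.commute[of _ "norm x"] flip: right_diff_distrib)
    qed
  qed
  ultimately show ?thesis by (rule that)
qed

text \<open>Each \<open>e * d i\<close> tends to 0 as \<open>e\<close> decreases to 0, and finitely
  many eventual properties hold simultaneously. This supplies the tolerances below.\<close>

lemma finite_uniform_pos:
  fixes c d :: "'i \<Rightarrow> real"
  assumes "finite I" "\<And>i. i \<in> I \<Longrightarrow> 0 < c i"
  obtains e where "0 < e" "\<And>i. i \<in> I \<Longrightarrow> e * d i < c i"
proof -
  have "\<forall>\<^sub>F e in at_right 0. \<forall>i\<in>I. e * d i < c i"
    using assms(1)
  proof (rule eventually_ball_finite, intro ballI)
    fix i assume "i \<in> I"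
    have "((\<lambda>e. e * d i) \<longlongrightarrow> 0 * d i) (at_right 0)" by (intro tendsto_intros)
    then show "\<forall>\<^sub>F e in at_right 0. e * d i < c i"
      using assms(2)[OF \<open>i \<in> I\<close>] by (simp add: order_tendsto_iff)
  qed
  then have "\<forall>\<^sub>F e in at_right 0. 0 < e \<and> (\<forall>i\<in>I. e * d i < c i)"
    using eventually_at_right_less[of "0::real"] by eventually_elim auto
  from eventually_happens'[OF _ this] obtain e where "0 < e" "\<forall>i\<in>I. e * d i < c i" by auto
  then show ?thesis using that by blast
qed

text \<open>The argument \<open>\<phi>\<close> is a function of coefficients, so that it can be a
  pseudonorm of linear combinations as well as the norm of the values of an operator.\<close>

definition lp_copy :: "ereal \<Rightarrow> real \<Rightarrow> real \<Rightarrow> nat \<Rightarrow> (c00 \<Rightarrow> real) \<Rightarrow> bool"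
  where "lp_copy p s r n \<phi> \<longleftrightarrow> (\<forall>a\<in>lp_space n. s * lp_norm p a \<le> \<phi> a \<and> \<phi> a \<le> r * lp_norm p a)"

text \<open>The slack \<open>\<delta>\<close> makes this an open condition on the pseudonorm \<open>\<nu>\<close>; it absorbs the
  loss from moving to a nearby pseudonorm. Taken for all \<open>m\<close>, the bound \<open>n \<ge> m\<close> forces infinite
  dimension.\<close>

definition approx_condition :: "ereal \<Rightarrow> real \<Rightarrow> nat \<Rightarrow> (c00 \<Rightarrow> real) \<Rightarrow> bool"
  where "approx_condition p lam m \<nu> \<longleftrightarrow>
    (\<exists>n\<ge>m. \<exists>w. \<exists>\<delta>>0. lp_copy p (1 + \<delta>) (lam + 1 / real (Suc m) - \<delta>) n (\<lambda>a. \<nu> (lincomb w a)) \<and>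
      (\<forall>i<m. \<exists>a\<in>lp_space n. \<nu> (Poly_Mapping.single i 1 - lincomb w a) < 1 / real (Suc m)))"

text \<open>The witnesses \<open>n\<close> and \<open>w\<close> for \<open>\<mu>0\<close> also serve
  every nearby pseudonorm, with \<open>\<delta>\<close> halved: all vectors involved are supported
  in one finite set of coordinates.\<close>

lemma openin_approx_condition:
  assumes p: "1 \<le> p"
  shows "openin (top_of_set pseudonorms) {\<mu>\<in>pseudonorms. approx_condition p lam m (extension \<mu>)}"
    (is "openin _ ?U")
proof (subst openin_subopen, intro ballI)
  fix \<mu>0 assume "\<mu>0 \<in> ?U"
  let ?E = "1 / real (Suc m)"
  let ?e = "\<lambda>i::nat. Poly_Mapping.single i (1::real)"
  from \<open>\<mu>0 \<in> ?U\<close> obtain n w \<delta> where \<mu>0: "\<mu>0 \<in> pseudonorms" and "n \<ge> m" "\<delta> > 0"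
    and copy: "lp_copy p (1 + \<delta>) (lam + ?E - \<delta>) n (\<lambda>a. extension \<mu>0 (lincomb w a))"
    and "\<forall>i<m. \<exists>a\<in>lp_space n. extension \<mu>0 (?e i - lincomb w a) < ?E"
    unfolding approx_condition_def by blast
  then obtain b where b: "\<And>i. i < m \<Longrightarrow> b i \<in> lp_space n"
    "\<And>i. i < m \<Longrightarrow> extension \<mu>0 (?e i - lincomb w (b i)) < ?E" by metis
  define W where "W = (\<Sum>i<n. norm (w i))"
  have W: "norm (lincomb w a) \<le> W * (real n * lp_norm p a)" if "a \<in> lp_space n" for a
  proof -
    have "norm (w i) \<le> W" if "i < n" for i
      unfolding W_def using that by (intro member_le_sum) auto
    then have "norm (lincomb w a) \<le> W * norm a"
      using that by (intro norm_lincomb_le) (auto simp: lp_space_def)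
    also have "\<dots> \<le> W * (real n * lp_norm p a)"
      using norm_le_lp_norm[OF p that] by (intro mult_left_mono) (auto simp: W_def sum_nonneg)
    finally show ?thesis .
  qed
  \<comment> \<open>The tolerance \<open>e1\<close> preserves the strict inequalities for the unit
    vectors; \<open>e2\<close> keeps the change in the two-sided bounds within
    \<open>\<delta> / 2\<close>.\<close>
  obtain e1 where e1: "0 < e1" "\<And>i. i < m \<Longrightarrow>
      e1 * norm (?e i - lincomb w (b i)) < ?E - extension \<mu>0 (?e i - lincomb w (b i))"
    by (rule finite_uniform_pos[of "{..<m}" "\<lambda>i. ?E - extension \<mu>0 (?e i - lincomb w (b i))"
          "\<lambda>i. norm (?e i - lincomb w (b i))"]) (use b in auto)
  obtain e2 where e2: "0 < e2" "e2 * (W * real n) < \<delta> / 2"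
    by (rule finite_uniform_pos[of "{()}" "\<lambda>_. \<delta> / 2" "\<lambda>_. W * real n"]) (use \<open>\<delta> > 0\<close> in auto)
  define e where "e = min e1 e2"
  have "0 < e" using e1 e2 by (simp add: e_def)
  define K where "K = {..<m} \<union> (\<Union>i<n. Poly_Mapping.keys (w i))"
  have K: "finite K" by (simp add: K_def)
  have keys: "Poly_Mapping.keys (lincomb w a) \<subseteq> K" if "a \<in> lp_space n" for a
  proof -
    have "Poly_Mapping.keys (lincomb w a) \<subseteq> (\<Union>i<n. Poly_Mapping.keys (Poly_Mapping.lookup a i *\<^sub>R w i))"
      unfolding lincomb_lp_space[OF that] by (rule keys_sum)
    also have "\<dots> \<subseteq> K" using keys_scaleR_subset unfolding K_def by blast
    finally show ?thesis .
  qed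
  from extension_close[OF \<mu>0 K \<open>0 < e\<close>] obtain N where N: "open N" "\<mu>0 \<in> N"
    "\<And>\<mu> x. \<mu> \<in> N \<Longrightarrow> \<mu> \<in> pseudonorms \<Longrightarrow> Poly_Mapping.keys x \<subseteq> K \<Longrightarrow>
      \<bar>extension \<mu> x - extension \<mu>0 x\<bar> \<le> e * norm x" by blast
  have "\<mu> \<in> ?U" if \<mu>: "\<mu> \<in> N" "\<mu> \<in> pseudonorms" for \<mu>
  proof -
    have "lp_copy p (1 + \<delta> / 2) (lam + ?E - \<delta> / 2) n (\<lambda>a. extension \<mu> (lincomb w a))"
      unfolding lp_copy_def
    proof
      fix a assume a: "a \<in> lp_space n"
      have "\<bar>extension \<mu> (lincomb w a) - extension \<mu>0 (lincomb w a)\<bar> \<le> e * norm (lincomb w a)"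
        by (intro N \<mu> keys a)
      also have "\<dots> \<le> e2 * (W * (real n * lp_norm p a))"
        using e2(1) by (intro mult_mono W a) (auto simp: e_def)
      also have "\<dots> \<le> \<delta> / 2 * lp_norm p a"
        using mult_right_mono[OF less_imp_le[OF e2(2)] lp_norm_nonneg[OF p, of a]] by (simp add: algebra_simps)
      finally have "\<bar>extension \<mu> (lincomb w a) - extension \<mu>0 (lincomb w a)\<bar> \<le> \<delta> / 2 * lp_norm p a" .
      moreover have "(1 + \<delta>) * lp_norm p a \<le> extension \<mu>0 (lincomb w a)"
        "extension \<mu>0 (lincomb w a) \<le> (lam + ?E - \<delta>) * lp_norm p a"
        using copy a by (auto simp: lp_copy_def)
      ultimately show "(1 + \<delta> / 2) * lp_norm p a \<le> extension \<mu> (lincomb w a) \<and>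
          extension \<mu> (lincomb w a) \<le> (lam + ?E - \<delta> / 2) * lp_norm p a"
        unfolding ring_distribs by linarith
    qed
    moreover have "extension \<mu> (?e i - lincomb w (b i)) < ?E" if "i < m" for i
    proof -
      have "Poly_Mapping.keys (?e i - lincomb w (b i)) \<subseteq> K"
        using keys_diff[of "?e i" "lincomb w (b i)"] keys[OF b(1)[OF that]] that
        by (auto simp: K_def)
      then have "\<bar>extension \<mu> (?e i - lincomb w (b i)) - extension \<mu>0 (?e i - lincomb w (b i))\<bar>
          \<le> e * norm (?e i - lincomb w (b i))" by (intro N \<mu>)
      also have "\<dots> \<le> e1 * norm (?e i - lincomb w (b i))" by (intro mult_right_mono) (auto simp: e_def)
      also have "\<dots> < ?E - extension \<mu>0 (?e i - lincomb w (b i))" by (rule e1(2)[OF that])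
      finally show ?thesis by linarith
    qed
    ultimately have "approx_condition p lam m (extension \<mu>)"
      unfolding approx_condition_def
      by (intro exI[of _ n] exI[of _ w] exI[of _ "\<delta> / 2"] conjI allI impI)
        (use \<open>n \<ge> m\<close> \<open>\<delta> > 0\<close> b(1) in auto)
    then show ?thesis using \<mu>(2) by simp
  qed
  moreover have "openin (top_of_set pseudonorms) (pseudonorms \<inter> N)" using N(1) by auto
  ultimately show "\<exists>T. openin (top_of_set pseudonorms) T \<and> \<mu>0 \<in> T \<and> T \<subseteq> ?U"
    using \<mu>0 N(2) by blast
qed

section \<open>Finite-dimensional subspaces\<close>

lemma infdist_approx:
  assumes "A \<noteq> {}" "0 < e"
  obtains a where "a \<in> A" "dist x a < infdist x A + e"
proof -
  have "(INF a\<in>A. dist x a) < infdist x A + e" using assms by (simp add: infdist_notempty)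
  then show ?thesis
    using that assms(1) by (subst (asm) cINF_less_iff) auto
qed

text \<open>This is the quotient seminorm modulo \<open>M\<close>. Near-optimal points of
  \<open>M\<close> are added and scaled, with an arbitrarily small error.\<close>

lemma pseudonorm_infdist:
  fixes M :: "'a::real_normed_vector set"
  assumes M: "subspace M"
  shows "pseudonorm (\<lambda>x. infdist x M)"
proof -
  have ne: "M \<noteq> {}" using subspace_0[OF M] by auto
  have add: "infdist (x + y) M \<le> infdist x M + infdist y M" for x y
  proof (rule field_le_epsilon)
    fix e :: real assume "0 < e"
    then obtain a b where a: "a \<in> M" "dist x a < infdist x M + e / 2"
      and b: "b \<in> M" "dist y b < infdist y M + e / 2"
      by (metis infdist_approx[OF ne] half_gt_zero)
    have "infdist (x + y) M \<le> dist (x + y) (a + b)" by (intro infdist_le subspace_add[OF M] a b)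
    also have "\<dots> \<le> dist x a + dist y b" by (rule dist_triangle_add)
    finally show "infdist (x + y) M \<le> infdist x M + infdist y M + e" using a b by linarith
  qed
  \<comment> \<open>The reverse inequality is this one applied to \<open>inverse c\<close> and
    \<open>c *\<^sub>R x\<close>.\<close>
  have le: "infdist (c *\<^sub>R x) M \<le> \<bar>c\<bar> * infdist x M" for c x
  proof (cases "c = 0")
    case True
    then show ?thesis using subspace_0[OF M] by simp
  next
    case False
    show ?thesis
    proof (rule field_le_epsilon)
      fix e :: real assume "0 < e"
      then obtain a where a: "a \<in> M" "dist x a < infdist x M + e / \<bar>c\<bar>"
        using infdist_approx[OF ne, of "e / \<bar>c\<bar>" x] False by auto
      have "infdist (c *\<^sub>R x) M \<le> dist (c *\<^sub>R x) (c *\<^sub>R a)" by (intro infdist_le subspace_scale[OF M] a)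
      also have "\<dots> = \<bar>c\<bar> * dist x a" by (simp add: dist_norm flip: scaleR_diff_right)
      also have "\<dots> \<le> \<bar>c\<bar> * (infdist x M + e / \<bar>c\<bar>)" using a(2) by (intro mult_left_mono) auto
      finally show "infdist (c *\<^sub>R x) M \<le> \<bar>c\<bar> * infdist x M + e"
        using False by (simp add: distrib_left)
    qed
  qed
  have "infdist (c *\<^sub>R x) M = \<bar>c\<bar> * infdist x M" for c x
  proof (cases "c = 0")
    case True
    then show ?thesis using subspace_0[OF M] by simp
  next
    case False
    then have "infdist x M \<le> \<bar>inverse c\<bar> * infdist (c *\<^sub>R x) M" using le[of "inverse c" "c *\<^sub>R x"] by simp
    then have "\<bar>c\<bar> * infdist x M \<le> infdist (c *\<^sub>R x) M"
      using False by (simp add: abs_inverse field_simps)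
    with le[of c x] show ?thesis by simp
  qed
  with add show ?thesis by (simp add: pseudonorm_def)
qed

text \<open>Hahn-Banach is applied to the quotient seminorm: a functional dominated by the distance
  to \<open>M\<close> vanishes on \<open>M\<close> and is bounded because \<open>M\<close> contains
  0. Closedness makes its value at \<open>x\<close> positive, so it can be normalised.\<close>

lemma separating_functional:
  fixes M :: "'a::real_normed_vector set"
  assumes M: "subspace M" "closed M" and "x \<notin> M"
  obtains g C where "linear g" "\<And>y. \<bar>g y\<bar> \<le> C * norm y" "\<And>y. y \<in> M \<Longrightarrow> g y = 0" "g x = 1"
proof -
  have pos: "0 < infdist x M"
    using M \<open>x \<notin> M\<close> subspace_0[OF M(1)] by (intro infdist_pos_not_in_closed) auto
  obtain f where f: "linear f" "\<And>y. \<bar>f y\<bar> \<le> infdist y M" "f x = infdist x M"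
    using norming_functional[OF pseudonorm_infdist[OF M(1)], of x] by metis
  show ?thesis
  proof (rule that[of "\<lambda>y. f y / infdist x M" "1 / infdist x M"])
    show "linear (\<lambda>y. f y / infdist x M)"
      using linear_compose_scale_right[OF f(1), of "1 / infdist x M"] by simp
    show "\<bar>f y / infdist x M\<bar> \<le> 1 / infdist x M * norm y" for y
      using f(2)[of y] infdist_le[OF subspace_0[OF M(1)], of y] pos
      by (simp add: divide_right_mono)
    show "f y / infdist x M = 0" if "y \<in> M" for y using f(2)[of y] that by simp
    show "f x / infdist x M = 1" using f(3) pos by simp
  qed
qed

text \<open>When a vector \<open>x\<close> outside the span is added, its coefficient is a bounded
  functional \<open>g\<close>. The new span is the preimage of the old one under the continuous map
  \<open>y - g y *\<^sub>R x\<close>.\<close>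

lemma closed_span_finite:
  fixes B :: "'a::real_normed_vector set"
  assumes "finite B"
  shows "closed (span B)"
  using assms
proof (induction B rule: finite_induct)
  case (insert x B)
  show ?case
  proof (cases "x \<in> span B")
    case True
    then show ?thesis using insert.IH by (simp add: span_redundant)
  next
    case False
    from separating_functional[OF subspace_span insert.IH this]
    obtain g C where g: "linear g" "\<And>y. \<bar>g y\<bar> \<le> C * norm y" "\<And>y. y \<in> span B \<Longrightarrow> g y = 0" "g x = 1"
      by metis
    have eq: "span (insert x B) = {y. y - g y *\<^sub>R x \<in> span B}"
    proof (intro set_eqI iffI)
      fix y assume "y \<in> span (insert x B)"
      then obtain k where k: "y - k *\<^sub>R x \<in> span B" by (auto simp: span_breakdown_eq)
      then have "g y = k" using g(3)[OF k] by (simp add: linear_diff[OF g(1)] linear_scale[OF g(1)] g(4))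
      then show "y \<in> {y. y - g y *\<^sub>R x \<in> span B}" using k by simp
    qed (auto simp: span_breakdown_eq)
    have "bounded_linear g"
      using g(1,2) by (intro bounded_linear_intro[of g C])
        (auto simp: linear_add linear_scale mult.commute)
    then have "continuous_on UNIV g" by (rule linear_continuous_on)
    then have "closed ((\<lambda>y. y - g y *\<^sub>R x) -` span B)"
      by (intro continuous_closed_vimage insert.IH continuous_intros)
        (auto simp: continuous_on_eq_continuous_at)
    then show ?thesis unfolding eq vimage_def .
  qed
qed simp

text \<open>Each basis vector is separated from the span of the others, which is closed.\<close>

lemma biorthogonal_functionals:
  fixes B :: "'a::real_normed_vector set"
  assumes "finite B" "independent B"
  obtains g C where "\<And>b. b \<in> B \<Longrightarrow> linear (g b)" "\<And>b y. b \<in> B \<Longrightarrow> \<bar>g b y\<bar> \<le> C b * norm y"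
    "\<And>b c. b \<in> B \<Longrightarrow> c \<in> B \<Longrightarrow> g b c = (if b = c then 1 else 0)"
proof -
  have "\<exists>g C. linear g \<and> (\<forall>y. \<bar>g y\<bar> \<le> C * norm y) \<and> (\<forall>c\<in>B. g c = (if b = c then 1 else 0))"
    if "b \<in> B" for b
  proof -
    have "b \<notin> span (B - {b})" using assms(2) that by (auto simp: dependent_def)
    then obtain g C where g: "linear g" "\<And>y. \<bar>g y\<bar> \<le> C * norm y"
      "\<And>y. y \<in> span (B - {b}) \<Longrightarrow> g y = 0" "g b = 1"
      using separating_functional[OF subspace_span closed_span_finite] assms(1) by (metis finite_Diff)
    moreover have "g c = 0" if "c \<in> B" "c \<noteq> b" for c
      using that by (intro g(3) span_base) auto
    ultimately show ?thesis by (intro exI[of _ g] exI[of _ C]) auto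
  qed
  then show ?thesis using that by metis
qed

section \<open>Bases and dimension counts\<close>

lemma finite_dim_basis:
  assumes "finite_dim E" "subspace E"
  obtains B where "finite B" "independent B" "span B = E" "card B = dim E"
proof -
  obtain B where B: "B \<subseteq> E" "independent B" "E \<subseteq> span B" "card B = dim E" by (rule basis_exists)
  obtain A where "finite A" "E \<subseteq> span A" using assms(1) by (auto simp: finite_dim_def)
  then have "finite B" using independent_span_bound[of A B] B by auto
  moreover have "span B = E" using B assms(2) by (simp add: span_eq_iff span_minimal subset_antisym)
  ultimately show ?thesis using B that by blast
qed

lemma card_le_dim:
  assumes "finite_dim E" "subspace E" "independent A" "A \<subseteq> E"
  shows "card A \<le> dim E"
  using finite_dim_basis[OF assms(1,2)] independent_span_bound assms(3,4) by metis

lemma infinite_dim_independent: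
  assumes "\<not> finite_dim X"
  obtains A where "A \<subseteq> X" "independent A" "finite A" "card A = m"
proof -
  obtain B where B: "B \<subseteq> X" "independent B" "X \<subseteq> span B" by (rule maximal_independent_subset)
  then have "infinite B" using assms by (auto simp: finite_dim_def)
  then obtain A where "finite A" "card A = m" "A \<subseteq> B" using infinite_arbitrarily_large by blast
  then show ?thesis using B that independent_mono by blast
qed

lemma finite_dim_image_lp_space:
  assumes "linear \<Phi>"
  shows "finite_dim (\<Phi> ` lp_space n)" "subspace (\<Phi> ` lp_space n)"
proof -
  have "\<Phi> ` lp_space n = span (\<Phi> ` (\<lambda>i. Poly_Mapping.single i 1) ` {..<n})"
    by (simp add: lp_space_eq_span linear_span_image[OF assms])
  then show "finite_dim (\<Phi> ` lp_space n)" unfolding finite_dim_def by (metis finite_imageI finite_lessThan order_refl)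
  show "subspace (\<Phi> ` lp_space n)" by (rule linear_subspace_image[OF assms subspace_lp_space])
qed

section \<open>Distance to the spaces \<open>\<ell>\<^sub>p\<^sup>n\<close>\<close>

lemma op_norm_upper: "x \<in> E \<Longrightarrow> \<nu> x \<le> 1 \<Longrightarrow> ereal (\<eta> (T x)) \<le> op_norm E \<nu> \<eta> T"
  unfolding op_norm_def by (intro SUP_upper) simp

lemma op_norm_least: "(\<And>x. x \<in> E \<Longrightarrow> \<nu> x \<le> 1 \<Longrightarrow> \<eta> (T x) \<le> r) \<Longrightarrow> op_norm E \<nu> \<eta> T \<le> ereal r"
  unfolding op_norm_def by (intro SUP_least) auto

lemma lp_copy_inj:
  assumes "1 \<le> p" "linear \<Phi>" "0 < s" "lp_copy p s r n (\<lambda>a. norm (\<Phi> a))"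
  shows "inj_on \<Phi> (lp_space n)"
proof -
  have "a = 0" if "a \<in> lp_space n" "\<Phi> a = 0" for a
  proof (rule ccontr)
    assume "a \<noteq> 0"
    then have "0 < s * lp_norm p a" using assms lp_norm_pos by simp
    then show False using assms(4) that by (auto simp: lp_copy_def)
  qed
  then show ?thesis
    using linear_inj_on_iff_eq_0[OF assms(2) subspace_lp_space] by blast
qed

text \<open>Injectivity preserves the dimension. This identifies the \<open>n\<close> of a copy with
  the \<open>dim F\<close> that appears in \<open>script_L\<close>.\<close>

lemma dim_lp_copy:
  assumes "1 \<le> p" "linear \<Phi>" "0 < s" "lp_copy p s r n (\<lambda>a. norm (\<Phi> a))"
  shows "dim (\<Phi> ` lp_space n) = n"
proof -
  obtain B where B: "B \<subseteq> lp_space n" "independent B" "lp_space n \<subseteq> span B" "card B = dim (lp_space n)"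
    by (rule basis_exists)
  have span: "span B = lp_space n" using B subspace_lp_space by (simp add: span_minimal subset_antisym)
  have inj: "inj_on \<Phi> (span B)" unfolding span by (rule lp_copy_inj[OF assms])
  have "independent (\<Phi> ` B)" by (rule linear_independent_injective_image[OF assms(2) B(2) inj])
  then have "dim (\<Phi> ` B) = card (\<Phi> ` B)" by (rule dim_eq_card_independent)
  also have "\<dots> = n"
    using inj_on_subset[OF inj span_superset] B(4) dim_lp_space by (simp add: card_image)
  finally show ?thesis by (metis span linear_span_image[OF assms(2)] dim_span)
qed

text \<open>The upper bound gives \<open>\<Phi>\<close> norm at most \<open>r\<close>, and the lower
  bound gives its inverse norm at most \<open>1 / s\<close>.\<close>

lemma banach_mazur_lp_copy:
  assumes p: "1 \<le> p" and \<Phi>: "linear \<Phi>" and s: "0 < s" and r: "0 \<le> r"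
    and copy: "lp_copy p s r n (\<lambda>a. norm (\<Phi> a))"
  shows "banach_mazur (\<Phi> ` lp_space n) norm (lp_space n) (lp_norm p) \<le> ereal (r / s)"
proof -
  let ?F = "\<Phi> ` lp_space n"
  obtain S where S: "linear S" "\<And>a. a \<in> lp_space n \<Longrightarrow> S (\<Phi> a) = a"
    using linear_exists_left_inverse_on[OF \<Phi> subspace_lp_space lp_copy_inj[OF p \<Phi> s copy]] by blast
  have bij: "bij_betw S ?F (lp_space n)"
    by (rule bij_betwI[of _ _ _ \<Phi>]) (auto simp: S)
  have inv: "inv_into ?F S a = \<Phi> a" if "a \<in> lp_space n" for a
    using that S bij by (intro inv_into_f_eq) (auto simp: bij_betw_def)
  have bound: "s * lp_norm p a \<le> norm (\<Phi> a)" "norm (\<Phi> a) \<le> r * lp_norm p a" if "a \<in> lp_space n" for a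
    using copy that by (auto simp: lp_copy_def)
  have 1: "op_norm ?F norm (lp_norm p) S \<le> ereal (1 / s)"
  proof (rule op_norm_least)
    fix x assume "x \<in> ?F" "norm x \<le> 1"
    then obtain a where a: "a \<in> lp_space n" "x = \<Phi> a" "s * lp_norm p a \<le> 1"
      using bound(1) order_trans by blast
    then show "lp_norm p (S x) \<le> 1 / s" using S s by (simp add: field_simps)
  qed
  have 2: "op_norm (lp_space n) (lp_norm p) norm (inv_into ?F S) \<le> ereal r"
  proof (rule op_norm_least)
    fix a assume a: "a \<in> lp_space n" "lp_norm p a \<le> 1"
    then have "r * lp_norm p a \<le> r" using r by (simp add: mult_left_le)
    then show "norm (inv_into ?F S a) \<le> r" using bound(2)[OF a(1)] by (simp add: inv a(1))
  qed
  \<comment> \<open>Multiplying the two bounds in \<open>ereal\<close> requires a sign; it comes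
    from the value at the zero vector.\<close>
  have 3: "0 \<le> op_norm (lp_space n) (lp_norm p) norm (inv_into ?F S)"
    using op_norm_upper[of 0 "lp_space n" "lp_norm p" norm "inv_into ?F S"] inv[of 0] subspace_0[OF subspace_lp_space]
    by (simp add: linear_0[OF \<Phi>] zero_ereal_def)
  have "banach_mazur ?F norm (lp_space n) (lp_norm p)
      \<le> op_norm ?F norm (lp_norm p) S * op_norm (lp_space n) (lp_norm p) norm (inv_into ?F S)"
    unfolding banach_mazur_def using S(1) bij by (intro Inf_lower) blast
  also have "\<dots> \<le> ereal (1 / s) * ereal r"
    using 1 2 3 s by (intro ereal_mult_mono) auto
  finally show ?thesis by simp
qed

lemma op_norm_bound:
  assumes E: "subspace E" and T: "\<And>c x. x \<in> E \<Longrightarrow> \<eta> (T (c *\<^sub>R x)) = \<bar>c\<bar> * \<eta> (T x)"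
    and \<nu>: "\<And>c x. x \<in> E \<Longrightarrow> \<nu> (c *\<^sub>R x) = \<bar>c\<bar> * \<nu> x"
    and x: "x \<in> E" "0 < \<nu> x"
  shows "ereal (\<eta> (T x) / \<nu> x) \<le> op_norm E \<nu> \<eta> T"
  using op_norm_upper[of "inverse (\<nu> x) *\<^sub>R x" E \<nu> \<eta> T] x subspace_scale[OF E x(1)] T[OF x(1)] \<nu>[OF x(1)]
  by (simp add: divide_inverse mult.commute)

text \<open>Some isomorphism has norm product below \<open>r\<close>. Its inverse, multiplied by the
  norm \<open>\<alpha>\<close> of the isomorphism, has lower constant 1, and all distortion sits in
  the upper constant.\<close>

lemma banach_mazur_obtain_copy:
  fixes F :: "'a::real_normed_vector set"
  assumes p: "1 \<le> p" and F: "subspace F" and n: "0 < n"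
    and less: "banach_mazur F norm (lp_space n) (lp_norm p) < ereal r"
  obtains \<Phi> where "linear \<Phi>" "\<Phi> ` lp_space n = F" "lp_copy p 1 r n (\<lambda>a. norm (\<Phi> a))"
proof -
  from less obtain S where S: "linear S" "bij_betw S F (lp_space n)"
    and AB: "op_norm F norm (lp_norm p) S * op_norm (lp_space n) (lp_norm p) norm (inv_into F S) < ereal r"
    by (auto simp: banach_mazur_def Inf_less_iff)
  define A where "A = op_norm F norm (lp_norm p) S"
  define B where "B = op_norm (lp_space n) (lp_norm p) norm (inv_into F S)"
  obtain R where R: "linear R" "\<And>x. x \<in> F \<Longrightarrow> R (S x) = x"
    using linear_exists_left_inverse_on[OF S(1) F] S(2) by (auto simp: bij_betw_def)
  have Sim: "S ` F = lp_space n" and inj: "inj_on S F" using S(2) by (auto simp: bij_betw_def)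
  have inv: "inv_into F S a = R a" if "a \<in> lp_space n" for a
    using that inj R(2) unfolding Sim[symmetric] by auto
  have SR: "S (R a) = a" "R a \<in> F" if "a \<in> lp_space n" for a
    using that R(2) unfolding Sim[symmetric] by auto
  have RF: "R ` lp_space n = F"
    unfolding Sim[symmetric] using R(2) by (auto simp: image_image)
  have A: "ereal (lp_norm p (S x) / norm x) \<le> A" if "x \<in> F" "x \<noteq> 0" for x
    unfolding A_def using that
    by (intro op_norm_bound F) (auto simp: linear_scale[OF S(1)] lp_norm_scaleR[OF p])
  have B: "ereal (norm (R a) / lp_norm p a) \<le> B" if a: "a \<in> lp_space n" "a \<noteq> 0" for a
    unfolding B_def inv[OF a(1), symmetric] using a lp_norm_pos[OF p]
    by (intro op_norm_bound subspace_lp_space)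
      (auto simp: inv subspace_scale[OF subspace_lp_space] linear_scale[OF R(1)] lp_norm_scaleR[OF p])
  \<comment> \<open>A nonzero vector exists because \<open>0 < n\<close>, and it makes both operator
    norms positive. Their product is below a real number, so neither can then be infinite.\<close>
  define e where "e = Poly_Mapping.single (0::nat) (1::real)"
  have e: "e \<in> lp_space n" "e \<noteq> 0"
    unfolding e_def by (rule single_in_lp_space[OF n]) simp
  then have Re: "R e \<noteq> 0" using SR(1)[OF e(1)] linear_0[OF S(1)] by metis
  have "0 < A"
    using A[OF SR(2)[OF e(1)] Re] lp_norm_pos[OF p e(2)] Re
    by (simp add: SR(1)[OF e(1)]) (meson divide_pos_pos ereal_less(2) less_le_trans zero_less_norm_iff)
  have "0 < B"
    using B[OF e] lp_norm_pos[OF p e(2)] Re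
    by (meson divide_pos_pos ereal_less(2) less_le_trans zero_less_norm_iff)
  obtain \<alpha> \<beta> where ab: "A = ereal \<alpha>" "B = ereal \<beta>"
    using AB \<open>0 < A\<close> \<open>0 < B\<close> unfolding A_def[symmetric] B_def[symmetric]
    by (cases A; cases B) auto
  have "0 < \<alpha>" "0 < \<beta>" "\<alpha> * \<beta> < r" using \<open>0 < A\<close> \<open>0 < B\<close> AB by (simp_all add: ab flip: A_def B_def)
  have "lp_copy p 1 r n (\<lambda>a. norm (\<alpha> *\<^sub>R R a))"
    unfolding lp_copy_def
  proof
    fix a assume a: "a \<in> lp_space n"
    show "1 * lp_norm p a \<le> norm (\<alpha> *\<^sub>R R a) \<and> norm (\<alpha> *\<^sub>R R a) \<le> r * lp_norm p a"
    proof (cases "a = 0")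
      case True
      then show ?thesis by (simp add: linear_0[OF R(1)])
    next
      case False
      then have "R a \<noteq> 0" using SR(1)[OF a] linear_0[OF S(1)] by metis
      then have "lp_norm p a \<le> \<alpha> * norm (R a)"
        using A[OF SR(2)[OF a]] by (simp add: ab SR(1)[OF a] field_simps)
      moreover have "norm (R a) \<le> \<beta> * lp_norm p a"
        using B[OF a False] lp_norm_pos[OF p False] by (simp add: ab field_simps)
      then have "\<alpha> * norm (R a) \<le> \<alpha> * (\<beta> * lp_norm p a)" using \<open>0 < \<alpha>\<close> by simp
      moreover have "\<alpha> * (\<beta> * lp_norm p a) \<le> r * lp_norm p a"
        using \<open>\<alpha> * \<beta> < r\<close> lp_norm_pos[OF p False] by (simp flip: mult.assoc)
      moreover have "norm (\<alpha> *\<^sub>R R a) = \<alpha> * norm (R a)" using \<open>0 < \<alpha>\<close> by simp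
      ultimately show ?thesis by linarith
    qed
  qed
  moreover have "linear (\<lambda>a. \<alpha> *\<^sub>R R a)" by (rule linear_compose_scale_right[OF R(1)])
  moreover have "(\<lambda>a. \<alpha> *\<^sub>R R a) ` lp_space n = F"
  proof -
    have "(\<lambda>x. \<alpha> *\<^sub>R x) ` F = F"
    proof
      show "(\<lambda>x. \<alpha> *\<^sub>R x) ` F \<subseteq> F" using subspace_scale[OF F] by auto
      show "F \<subseteq> (\<lambda>x. \<alpha> *\<^sub>R x) ` F"
        using subspace_scale[OF F] \<open>0 < \<alpha>\<close> by (intro subsetI image_eqI[of _ _ "inverse \<alpha> *\<^sub>R _"]) auto
    qed
    then show ?thesis using RF by (metis image_image)
  qed
  ultimately show ?thesis using that by blast
qed

lemma lincomb_diff: "lincomb (\<lambda>i. v i - w i) a = lincomb v a - lincomb w a"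
  by (simp add: lincomb_def scaleR_diff_right sum_subtractf)

lemma lincomb_in_subspace:
  assumes "subspace S" "\<And>i. i \<in> Poly_Mapping.keys a \<Longrightarrow> w i \<in> S"
  shows "lincomb w a \<in> S"
  unfolding lincomb_def using assms by (intro subspace_sum subspace_scale)

text \<open>The closure is the zero set of the quotient seminorm, and the zero set of a pseudonorm
  is a subspace.\<close>

lemma subspace_closure_range:
  fixes T :: "'a::real_vector \<Rightarrow> 'b::real_normed_vector"
  assumes "linear T"
  shows "subspace (closure (range T))"
proof -
  have M: "subspace (range T)" by (rule linear_subspace_image[OF assms subspace_UNIV])
  note pn = pseudonormD[OF pseudonorm_infdist[OF M]]
  have "closure (range T) = {x. infdist x (range T) = 0}"
    by (auto simp: in_closure_iff_infdist_zero)
  moreover have "subspace {x. infdist x (range T) = 0}"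
  proof (rule subspaceI)
    fix x y :: 'b and c :: real
    assume x: "x \<in> {x. infdist x (range T) = 0}"
    then show "c *\<^sub>R x \<in> {x. infdist x (range T) = 0}" by (simp add: pn(2))
    assume "y \<in> {x. infdist x (range T) = 0}"
    then show "x + y \<in> {x. infdist x (range T) = 0}"
      using pn(1)[of x y] pn(6)[of "x + y"] x by simp
  qed (simp add: pn(3))
  ultimately show ?thesis by simp
qed

section \<open>Characterization of the spaces\<close>

lemma approx_condition_if_script_L_plus:
  fixes T :: "c00 \<Rightarrow> 'b::banach"
  assumes p: "1 \<le> p" and lam: "1 \<le> lam" and T: "linear T"
    and inf: "\<not> finite_dim (closure (range T))"
    and script: "script_L_plus p lam (closure (range T))"
  shows "approx_condition p lam m (\<lambda>x. norm (T x))"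
proof -
  let ?X = "closure (range T)"
  let ?e = "\<lambda>i::nat. Poly_Mapping.single i (1::real)"
  define \<epsilon> where "\<epsilon> = 1 / real (Suc m)"
  have "0 < \<epsilon>" by (simp add: \<epsilon>_def)
  have X: "subspace ?X" by (rule subspace_closure_range[OF T])
  have TX: "T x \<in> ?X" for x by (rule subsetD[OF closure_subset]) simp
  \<comment> \<open>Including \<open>Suc m\<close> independent vectors in \<open>E\<close> forces
    \<open>n \<ge> m\<close> and \<open>0 < n\<close>, even if the images of the unit vectors are
    dependent.\<close>
  obtain A where A: "A \<subseteq> ?X" "independent A" "finite A" "card A = Suc m"
    by (rule infinite_dim_independent[OF inf])
  define E where "E = span (A \<union> (\<lambda>i. T (?e i)) ` {..<m})"
  have "E \<subseteq> ?X" unfolding E_def using A(1) TX by (intro span_minimal X) blast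
  moreover have "finite_dim E"
    unfolding E_def finite_dim_def using A(3)
    by (intro exI[of _ "A \<union> (\<lambda>i. T (?e i)) ` {..<m}"]) simp
  moreover have "subspace E" unfolding E_def by (rule subspace_span)
  moreover have "script_L p (lam + \<epsilon> / 3) ?X"
    using script \<open>0 < \<epsilon>\<close> by (simp add: script_L_plus_def)
  ultimately obtain F where F: "subspace F" "finite_dim F" "E \<subseteq> F" "F \<subseteq> ?X"
    and bm: "banach_mazur F norm (lp_space (dim F)) (lp_norm p) \<le> ereal (lam + \<epsilon> / 3)"
    unfolding script_L_def by blast
  define n where "n = dim F"
  have "A \<subseteq> F" using F(3) span_superset unfolding E_def by blast
  then have "Suc m \<le> n" using card_le_dim[OF F(2,1) A(2)] A(4) by (simp add: n_def)
  then have "0 < n" by simp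
  have "banach_mazur F norm (lp_space n) (lp_norm p) < ereal (lam + \<epsilon> / 2)"
    using bm \<open>0 < \<epsilon>\<close> unfolding n_def by (rule_tac le_less_trans) auto
  from banach_mazur_obtain_copy[OF p F(1) \<open>0 < n\<close> this]
  obtain \<Phi> where \<Phi>: "linear \<Phi>" "\<Phi> ` lp_space n = F"
    and copy: "lp_copy p 1 (lam + \<epsilon> / 2) n (\<lambda>a. norm (\<Phi> a))" by blast
  \<comment> \<open>Scaling by \<open>1 + 2 * \<delta>\<close> and then perturbing by
    \<open>\<delta>\<close> must leave a lower constant of \<open>1 + \<delta>\<close> and an upper
    one of \<open>lam + \<epsilon> - \<delta>\<close>; this value achieves both.\<close>
  define \<delta> where "\<delta> = \<epsilon> / (4 * (lam + \<epsilon> + 1))"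
  have "0 < \<delta>" using \<open>0 < \<epsilon>\<close> lam by (simp add: \<delta>_def)
  have up: "(1 + 2 * \<delta>) * (lam + \<epsilon> / 2) + \<delta> \<le> lam + \<epsilon> - \<delta>"
  proof -
    have "4 * (\<epsilon> / (4 * K)) * K = \<epsilon>" if "K \<noteq> 0" for K :: real using that by simp
    from this[of "lam + \<epsilon> + 1"] have "4 * \<delta> * (lam + \<epsilon> + 1) = \<epsilon>"
      using \<open>0 < \<epsilon>\<close> lam unfolding \<delta>_def by linarith
    moreover have "0 \<le> \<delta> * \<epsilon>" using \<open>0 < \<epsilon>\<close> \<open>0 < \<delta>\<close> by simp
    ultimately show ?thesis by (simp add: algebra_simps)
  qed
  define \<Psi> where "\<Psi> = (\<lambda>a. (1 + 2 * \<delta>) *\<^sub>R \<Phi> a)"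
  have \<Psi>: "linear \<Psi>" unfolding \<Psi>_def by (rule linear_compose_scale_right[OF \<Phi>(1)])
  have \<Psi>F: "\<Psi> a \<in> F" if "a \<in> lp_space n" for a
    using \<Phi>(2) that subspace_scale[OF F(1)] unfolding \<Psi>_def by blast
  have "\<exists>b\<in>lp_space n. T (?e i) = \<Psi> b" if "i < m" for i
  proof -
    have "T (?e i) \<in> F" using F(3) that unfolding E_def by (auto intro!: span_base)
    then obtain c where c: "c \<in> lp_space n" "T (?e i) = \<Phi> c" using \<Phi>(2) by blast
    have "\<Psi> (inverse (1 + 2 * \<delta>) *\<^sub>R c) = \<Phi> c"
      using \<open>0 < \<delta>\<close> by (simp add: \<Psi>_def linear_scale[OF \<Phi>(1)])
    then show ?thesis using c subspace_scale[OF subspace_lp_space c(1)] by metis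
  qed
  then obtain b where b: "\<And>i. i < m \<Longrightarrow> b i \<in> lp_space n" "\<And>i. i < m \<Longrightarrow> T (?e i) = \<Psi> (b i)"
    by metis
  obtain \<theta>1 where \<theta>1: "0 < \<theta>1" "\<And>i. i < m \<Longrightarrow> \<theta>1 * lp_norm p (b i) < \<epsilon>"
    by (rule finite_uniform_pos[of "{..<m}" "\<lambda>_. \<epsilon>" "\<lambda>i. lp_norm p (b i)"]) (use \<open>0 < \<epsilon>\<close> in auto)
  define \<theta> where "\<theta> = min \<delta> \<theta>1"
  have "0 < \<theta>" using \<theta>1 \<open>0 < \<delta>\<close> by (simp add: \<theta>_def)
  \<comment> \<open>The range of \<open>T\<close> is dense in its closure. Dividing by
    \<open>n\<close> cancels the factor from \<open>norm_le_lp_norm\<close>.\<close>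
  have "\<exists>v. norm (T v - \<Psi> (?e i)) \<le> \<theta> / real n" if "i < n" for i
  proof -
    have "\<Psi> (?e i) \<in> ?X" using F(4) \<Psi>F[OF single_in_lp_space[OF that]] by blast
    then have "\<exists>y\<in>range T. dist y (\<Psi> (?e i)) < \<theta> / real n"
      using \<open>0 < \<theta>\<close> \<open>0 < n\<close> by (simp only: closure_approachable) simp
    then show ?thesis by (auto simp: dist_norm intro: less_imp_le)
  qed
  then obtain w where w: "\<And>i. i < n \<Longrightarrow> norm (T (w i) - \<Psi> (?e i)) \<le> \<theta> / real n" by metis
  have close: "norm (T (lincomb w a) - \<Psi> a) \<le> \<theta> * lp_norm p a" if a: "a \<in> lp_space n" for a
  proof -
    have "T (lincomb w a) - \<Psi> a = lincomb (\<lambda>i. T (w i) - \<Psi> (?e i)) a"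
      unfolding lincomb_diff linear_image_lincomb[OF T] by (subst linear_eq_lincomb[OF \<Psi>]) simp
    also have "norm \<dots> \<le> \<theta> / real n * norm a"
      using a w by (intro norm_lincomb_le) (auto simp: lp_space_def)
    also have "\<dots> \<le> \<theta> / real n * (real n * lp_norm p a)"
      using \<open>0 < \<theta>\<close> by (intro mult_left_mono norm_le_lp_norm p a) auto
    finally show ?thesis using \<open>0 < n\<close> by simp
  qed
  have "lp_copy p (1 + \<delta>) (lam + \<epsilon> - \<delta>) n (\<lambda>a. norm (T (lincomb w a)))"
    unfolding lp_copy_def
  proof
    fix a assume a: "a \<in> lp_space n"
    let ?l = "lp_norm p a"
    have l: "0 \<le> ?l" by (rule lp_norm_nonneg[OF p])
    have "norm (T (lincomb w a) - \<Psi> a) \<le> \<delta> * ?l"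
      using close[OF a] mult_right_mono[OF _ l, of \<theta> \<delta>] by (simp add: \<theta>_def)
    moreover have "\<bar>norm (T (lincomb w a)) - norm (\<Psi> a)\<bar> \<le> norm (T (lincomb w a) - \<Psi> a)"
      by (rule norm_triangle_ineq3)
    moreover have "norm (\<Psi> a) = (1 + 2 * \<delta>) * norm (\<Phi> a)" using \<open>0 < \<delta>\<close> by (simp add: \<Psi>_def)
    moreover have "(1 + 2 * \<delta>) * ?l \<le> (1 + 2 * \<delta>) * norm (\<Phi> a)"
      "(1 + 2 * \<delta>) * norm (\<Phi> a) \<le> (1 + 2 * \<delta>) * ((lam + \<epsilon> / 2) * ?l)"
      using copy a \<open>0 < \<delta>\<close> by (auto simp: lp_copy_def)
    moreover have "((1 + 2 * \<delta>) * (lam + \<epsilon> / 2) + \<delta>) * ?l \<le> (lam + \<epsilon> - \<delta>) * ?l"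
      by (rule mult_right_mono[OF up l])
    ultimately show "(1 + \<delta>) * ?l \<le> norm (T (lincomb w a)) \<and> norm (T (lincomb w a)) \<le> (lam + \<epsilon> - \<delta>) * ?l"
      by (simp only: distrib_right mult.assoc) linarith
  qed
  moreover have "norm (T (?e i - lincomb w (b i))) < \<epsilon>" if "i < m" for i
  proof -
    have "norm (T (?e i - lincomb w (b i))) \<le> \<theta> * lp_norm p (b i)"
      using close[OF b(1)[OF that]] by (simp add: linear_diff[OF T] b(2)[OF that] norm_minus_commute)
    also have "\<dots> \<le> \<theta>1 * lp_norm p (b i)"
      by (intro mult_right_mono lp_norm_nonneg p) (simp add: \<theta>_def)
    finally show ?thesis using \<theta>1(2)[OF that] by linarith
  qed
  then have "\<forall>i<m. \<exists>a\<in>lp_space n. norm (T (?e i - lincomb w a)) < \<epsilon>" using b(1) by blast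
  ultimately show ?thesis
    unfolding approx_condition_def \<epsilon>_def[symmetric]
    by (intro exI[of _ n] exI[of _ w] exI[of _ \<delta>] conjI)
      (use \<open>Suc m \<le> n\<close> \<open>0 < \<delta>\<close> in \<open>simp_all only: Suc_leD\<close>)
qed

lemma infinite_dim_if_approx_condition:
  fixes T :: "c00 \<Rightarrow> 'b::banach"
  assumes p: "1 \<le> p" and T: "linear T"
    and cond: "\<And>m. approx_condition p lam m (\<lambda>x. norm (T x))"
  shows "\<not> finite_dim (closure (range T))"
proof
  let ?X = "closure (range T)"
  assume fin: "finite_dim ?X"
  \<comment> \<open>This \<open>m\<close> yields a copy whose dimension exceeds that of the space
    containing it.\<close>
  from cond[of "Suc (dim ?X)"] obtain n w \<delta> r where n: "Suc (dim ?X) \<le> n" and "0 < \<delta>"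
    and copy: "lp_copy p (1 + \<delta>) r n (\<lambda>a. norm (T (lincomb w a)))"
    unfolding approx_condition_def by blast
  have lin: "linear (\<lambda>a. T (lincomb w a))"
    using linear_compose[OF linear_lincomb T] by (simp add: o_def)
  have dim: "dim ((\<lambda>a. T (lincomb w a)) ` lp_space n) = n"
    using \<open>0 < \<delta>\<close> by (intro dim_lp_copy[OF p lin _ copy]) simp
  obtain B where B: "independent B" "span B = (\<lambda>a. T (lincomb w a)) ` lp_space n" "card B = n"
    using finite_dim_basis[OF finite_dim_image_lp_space[OF lin]] dim by metis
  have "B \<subseteq> ?X" using B(2) span_superset closure_subset[of "range T"] by blast
  then have "n \<le> dim ?X" using card_le_dim[OF fin subspace_closure_range[OF T] B(1)] B(3) by simp
  then show False using n by simp
qed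

text \<open>The expression tends to \<open>lam\<close> as \<open>t\<close> decreases to 0. It is the
  quotient of the two constants left after inverting a \<open>t\<close>-perturbation of the
  identity.\<close>

lemma small_distortion:
  assumes "lam < (lam'::real)"
  obtains t where "0 < t" "t < 1" "(lam + t) / (1 - t) / (1 / (1 + t)) < lam'"
proof -
  have "((\<lambda>t. (lam + t) / (1 - t) / (1 / (1 + t))) \<longlongrightarrow> (lam + 0) / (1 - 0) / (1 / (1 + 0))) (at_right 0)"
    by (intro tendsto_intros) auto
  then have "\<forall>\<^sub>F t in at_right 0. (lam + t) / (1 - t) / (1 / (1 + t)) < lam'"
    using assms by (intro order_tendstoD) auto
  moreover have "\<forall>\<^sub>F t in at_right (0::real). t \<in> {0<..<1}" by (rule eventually_at_right_real) simp
  ultimately have "\<forall>\<^sub>F t in at_right 0. t \<in> {0<..<1} \<and> (lam + t) / (1 - t) / (1 / (1 + t)) < lam'"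
    by eventually_elim simp
  from eventually_happens'[OF _ this] that show ?thesis by auto
qed

text \<open>A solution is a fixed point of the contraction that takes \<open>y\<close> to
  \<open>z - P y\<close>.\<close>

lemma surj_perturbation:
  fixes P :: "'b::banach \<Rightarrow> 'b"
  assumes P: "linear P" "\<And>y. norm (P y) \<le> t * norm y" and t: "0 \<le> t" "t < 1"
  shows "\<exists>y. y + P y = z"
proof -
  have "dist (z - P x) (z - P y) \<le> t * dist x y" for x y
    using P(2)[of "x - y"] linear_diff[OF P(1), of x y] by (simp add: dist_norm norm_minus_commute)
  then obtain y where "z - P y = y" using banach_fix_type[OF t, of "\<lambda>y. z - P y"] by blast
  then have "y + P y = z" by (simp add: eq_diff_eq diff_eq_eq)
  then show ?thesis ..
qed

lemma script_L_if_approx_condition: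
  fixes T :: "c00 \<Rightarrow> 'b::banach"
  assumes p: "1 \<le> p" and lam: "1 \<le> lam" "lam < lam'" and T: "linear T"
    and cond: "\<And>m. approx_condition p lam m (\<lambda>x. norm (T x))"
  shows "script_L p lam' (closure (range T))"
  unfolding script_L_def
proof (intro allI impI, elim conjE)
  let ?X = "closure (range T)"
  let ?e = "\<lambda>i::nat. Poly_Mapping.single i (1::real)"
  fix E assume E: "subspace E" "finite_dim E" "E \<subseteq> ?X"
  have X: "subspace ?X" by (rule subspace_closure_range[OF T])
  have TX: "T x \<in> ?X" for x by (rule subsetD[OF closure_subset]) simp
  obtain B where B: "finite B" "independent B" "span B = E" by (rule finite_dim_basis[OF E(2,1)])
  have BX: "B \<subseteq> ?X" using B(3) E(3) span_superset by blast
  obtain g C where g: "\<And>b. b \<in> B \<Longrightarrow> linear (g b)" "\<And>b y. b \<in> B \<Longrightarrow> \<bar>g b y\<bar> \<le> C b * norm y"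
    "\<And>b c. b \<in> B \<Longrightarrow> c \<in> B \<Longrightarrow> g b c = (if b = c then 1 else 0)"
    using biorthogonal_functionals[OF B(1,2)] by metis
  obtain t where t: "0 < t" "t < 1" "(lam + t) / (1 - t) / (1 / (1 + t)) < lam'"
    by (rule small_distortion[OF lam(2)])
  \<comment> \<open>The perturbation has norm at most \<open>(D - 1) * \<eta>\<close>, which is at
    most \<open>t\<close> for \<open>\<eta> = t / D\<close>; the summand 1 keeps \<open>D\<close>
    positive even for empty \<open>B\<close>.\<close>
  define D where "D = 1 + (\<Sum>b\<in>B. \<bar>C b\<bar>)"
  have "0 < D" unfolding D_def by (intro add_pos_nonneg sum_nonneg) auto
  define \<eta> where "\<eta> = t / D"
  have "0 < \<eta>" using t \<open>0 < D\<close> by (simp add: \<eta>_def)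
  have "\<exists>y. norm (T y - b) < \<eta> / 2" if "b \<in> B" for b
  proof -
    have "\<exists>y\<in>range T. dist y b < \<eta> / 2"
      using subsetD[OF BX that] half_gt_zero[OF \<open>0 < \<eta>\<close>] unfolding closure_approachable by blast
    then show ?thesis by (auto simp: dist_norm)
  qed
  then obtain y where y: "\<And>b. b \<in> B \<Longrightarrow> norm (T (y b) - b) < \<eta> / 2" by metis
  obtain e where e: "0 < e" "\<And>b. b \<in> B \<Longrightarrow> e * norm (y b) < \<eta> / 2"
    by (rule finite_uniform_pos[OF B(1), of "\<lambda>_. \<eta> / 2" "\<lambda>b. norm (y b)"]) (use \<open>0 < \<eta>\<close> in auto)
  obtain m0 where m0: "inverse (real (Suc m0)) < min e t"
    using reals_Archimedean[of "min e t"] e(1) t(1) by auto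
  have "finite (\<Union>b\<in>B. Poly_Mapping.keys (y b))" using B(1) by simp
  then obtain k where k: "(\<Union>b\<in>B. Poly_Mapping.keys (y b)) \<subseteq> {..<k}"
    using finite_nat_bounded by blast
  \<comment> \<open>Here \<open>m0\<close> makes the error \<open>\<epsilon>\<close> small enough,
    and \<open>k\<close> ensures that every \<open>y b\<close> involves only the first
    \<open>m\<close> unit vectors.\<close>
  define m where "m = max m0 k"
  define \<epsilon> where "\<epsilon> = 1 / real (Suc m)"
  have "\<epsilon> \<le> inverse (real (Suc m0))" by (simp add: \<epsilon>_def m_def field_simps)
  then have \<epsilon>: "\<epsilon> \<le> e" "\<epsilon> \<le> t" using m0 by auto
  from cond[of m] obtain n w \<delta> where "0 < \<delta>"
    and copy: "lp_copy p (1 + \<delta>) (lam + \<epsilon> - \<delta>) n (\<lambda>a. norm (T (lincomb w a)))"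
    and "\<forall>i<m. \<exists>a\<in>lp_space n. norm (T (?e i - lincomb w a)) < \<epsilon>"
    unfolding approx_condition_def \<epsilon>_def by blast
  then obtain a where a: "\<And>i. i < m \<Longrightarrow> a i \<in> lp_space n"
    "\<And>i. i < m \<Longrightarrow> norm (T (?e i - lincomb w (a i))) < \<epsilon>" by metis
  have keys: "i < m" if "b \<in> B" "i \<in> Poly_Mapping.keys (y b)" for b i
    using k that by (auto simp: m_def)
  \<comment> \<open>Replacing each unit vector in \<open>y b\<close> by its approximation
    \<open>lincomb w (a i)\<close> gives a combination of the \<open>w i\<close> with coefficients
    \<open>c b\<close>.\<close>
  define c where "c b = lincomb a (y b)" for b
  have c: "c b \<in> lp_space n" if "b \<in> B" for b
    unfolding c_def using a(1) keys[OF that] by (intro lincomb_in_subspace subspace_lp_space) auto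
  define u where "u b = T (lincomb w (c b))" for b
  have u: "norm (u b - b) \<le> \<eta>" if "b \<in> B" for b
  proof -
    have "T (y b) - u b = lincomb (\<lambda>i. T (?e i - lincomb w (a i))) (y b)"
      unfolding linear_diff[OF T] lincomb_diff u_def c_def linear_image_lincomb[OF linear_lincomb]
      using linear_eq_lincomb[OF T, of "y b"] linear_image_lincomb[OF T, of "\<lambda>i. lincomb w (a i)" "y b"]
      by simp
    also have "norm \<dots> \<le> \<epsilon> * norm (y b)"
      using a(2) keys[OF that] by (intro norm_lincomb_le) (simp add: less_imp_le)
    also have "\<dots> \<le> e * norm (y b)" by (intro mult_right_mono \<epsilon>) simp
    finally have "norm (T (y b) - u b) < \<eta> / 2" using e(2)[OF that] by linarith
    moreover have "norm (u b - b) \<le> norm (T (y b) - u b) + norm (T (y b) - b)"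
      using norm_triangle_ineq4[of "T (y b) - b" "T (y b) - u b"] by (simp add: algebra_simps)
    ultimately show ?thesis using y[OF that] by linarith
  qed
  \<comment> \<open>\<open>J = I + P\<close> is close to the identity and sends each \<open>b\<close> to \<open>u b\<close>, so the copy of \<open>\<ell>\<^sub>p\<^sup>n\<close>
    containing the \<open>u b\<close> pulls back to a copy containing \<open>E\<close>.\<close>
  define P where "P x = (\<Sum>b\<in>B. g b x *\<^sub>R (u b - b))" for x
  have P: "linear P"
    by (rule linearI)
      (auto simp: P_def linear_add[OF g(1)] linear_scale[OF g(1)] scaleR_left_distrib
        sum.distrib scaleR_sum_right intro!: sum.cong)
  have Pt: "norm (P x) \<le> t * norm x" for x
  proof -
    have "norm (P x) \<le> (\<Sum>b\<in>B. \<bar>g b x\<bar> * norm (u b - b))"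
      unfolding P_def by (rule order_trans[OF norm_sum]) simp
    also have "\<dots> \<le> (\<Sum>b\<in>B. \<bar>C b\<bar> * norm x * \<eta>)"
    proof (intro sum_mono mult_mono u)
      fix b assume "b \<in> B"
      show "\<bar>g b x\<bar> \<le> \<bar>C b\<bar> * norm x"
        by (rule order_trans[OF g(2)[OF \<open>b \<in> B\<close>]]) (simp add: mult_right_mono)
    qed auto
    also have "\<dots> = (D - 1) * \<eta> * norm x"
      by (simp add: D_def mult.commute mult.left_commute flip: sum_distrib_left)
    also have "\<dots> \<le> t * norm x"
      using \<open>0 < D\<close> t(1) by (intro mult_right_mono) (auto simp: \<eta>_def field_simps)
    finally show ?thesis .
  qed
  have PX: "P x \<in> ?X" for x
    unfolding P_def u_def using BX TX X by (intro subspace_sum subspace_scale subspace_diff) auto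
  define J where "J x = x + P x" for x
  have J: "linear J" unfolding J_def by (intro linear_compose_add linear_ident P)
  have J_bound: "(1 - t) * norm x \<le> norm (J x)" "norm (J x) \<le> (1 + t) * norm x" for x
    using Pt[of x] norm_triangle_ineq[of x "P x"] norm_diff_ineq[of x "P x"]
    by (simp_all add: J_def algebra_simps)
  have J_inj: "x = x'" if "J x = J x'" for x x'
  proof -
    have "(1 - t) * norm (x - x') \<le> 0"
      using J_bound(1)[of "x - x'"] that by (simp add: linear_diff[OF J])
    then show ?thesis using t(2) by (simp add: mult_le_0_iff)
  qed
  have "\<exists>f. J f = T (w i)" for i
    unfolding J_def using t by (intro surj_perturbation[OF P Pt]) auto
  then obtain f where f: "\<And>i. J (f i) = T (w i)" by metis
  \<comment> \<open>The equation was solved in the ambient Banach space; the solution lies in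
    \<open>?X\<close> because \<open>P\<close> takes values there.\<close>
  have fX: "f i \<in> ?X" for i
  proof -
    have "f i = T (w i) - P (f i)" unfolding f[symmetric] J_def by simp
    then show ?thesis using subspace_diff[OF X TX PX] by metis
  qed
  define \<Phi> where "\<Phi> = lincomb f"
  have \<Phi>: "linear \<Phi>" unfolding \<Phi>_def by (rule linear_lincomb)
  have J\<Phi>: "J (\<Phi> x) = T (lincomb w x)" for x
    by (simp add: \<Phi>_def linear_image_lincomb[OF J] linear_image_lincomb[OF T] f)
  \<comment> \<open>Passing from \<open>J (\<Phi> x)\<close> to \<open>\<Phi> x\<close> divides the
    lower constant by \<open>1 + t\<close> and the upper one by \<open>1 - t\<close>.\<close>
  let ?s = "1 / (1 + t)" and ?r = "(lam + t) / (1 - t)"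
  have "0 < ?s" "0 \<le> ?r" using t lam by auto
  have copy\<Phi>: "lp_copy p ?s ?r n (\<lambda>a. norm (\<Phi> a))"
    unfolding lp_copy_def
  proof
    fix x assume "x \<in> lp_space n"
    let ?l = "lp_norm p x"
    have l: "0 \<le> ?l" by (rule lp_norm_nonneg[OF p])
    have "(1 + \<delta>) * ?l \<le> norm (J (\<Phi> x))" "norm (J (\<Phi> x)) \<le> (lam + \<epsilon> - \<delta>) * ?l"
      using copy \<open>x \<in> lp_space n\<close> unfolding J\<Phi> by (auto simp: lp_copy_def)
    moreover have "1 * ?l \<le> (1 + \<delta>) * ?l" by (rule mult_right_mono[OF _ l]) (use \<open>0 < \<delta>\<close> in simp)
    moreover have "(lam + \<epsilon> - \<delta>) * ?l \<le> (lam + t) * ?l"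
      by (rule mult_right_mono[OF _ l]) (use \<open>0 < \<delta>\<close> \<epsilon>(2) in simp)
    ultimately have "?l \<le> (1 + t) * norm (\<Phi> x)" "(1 - t) * norm (\<Phi> x) \<le> (lam + t) * ?l"
      using J_bound[of "\<Phi> x"] by linarith+
    then show "?s * ?l \<le> norm (\<Phi> x) \<and> norm (\<Phi> x) \<le> ?r * ?l"
      using t by (simp add: field_simps)
  qed
  let ?F = "\<Phi> ` lp_space n"
  note F = finite_dim_image_lp_space[OF \<Phi>, of n]
  have "b \<in> ?F" if "b \<in> B" for b
  proof -
    have "P b = (\<Sum>d\<in>B. if d = b then u b - b else 0)"
      unfolding P_def using g(3) that by (intro sum.cong) auto
    then have "J b = u b" using B(1) that by (simp add: J_def)
    then have "J b = J (\<Phi> (c b))" by (simp add: J\<Phi> u_def)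
    then have "b = \<Phi> (c b)" by (rule J_inj)
    then show ?thesis using c[OF that] by blast
  qed
  then have "E \<subseteq> ?F" unfolding B(3)[symmetric] using F(2) by (intro span_minimal) auto
  moreover have "?F \<subseteq> ?X" unfolding \<Phi>_def using fX X by (auto intro!: lincomb_in_subspace)
  moreover have "banach_mazur ?F norm (lp_space (dim ?F)) (lp_norm p) \<le> ereal lam'"
  proof -
    have "dim ?F = n" by (rule dim_lp_copy[OF p \<Phi> \<open>0 < ?s\<close> copy\<Phi>])
    then have "banach_mazur ?F norm (lp_space (dim ?F)) (lp_norm p) \<le> ereal (?r / ?s)"
      using banach_mazur_lp_copy[OF p \<Phi> \<open>0 < ?s\<close> \<open>0 \<le> ?r\<close> copy\<Phi>] by simp
    also have "\<dots> \<le> ereal lam'" using t(3) by simp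
    finally show ?thesis .
  qed
  ultimately show "\<exists>F. subspace F \<and> finite_dim F \<and> E \<subseteq> F \<and> F \<subseteq> ?X \<and>
      banach_mazur F norm (lp_space (dim F)) (lp_norm p) \<le> ereal lam'"
    using F by blast
qed

theorem theorem3p6:
  fixes p :: ereal and lam :: real
  assumes "1 \<le> p" and "1 \<le> lam"
  shows "gdelta_in (top_of_set pseudonorms)
           {\<mu> \<in> pseudonorms. \<not> finite_dim (X_space \<mu>) \<and> script_L_plus p lam (X_space \<mu>)}
       \<and> gdelta_in (top_of_set pseudonorms_inf)
           {\<mu> \<in> pseudonorms. \<not> finite_dim (X_space \<mu>) \<and> script_L_plus p lam (X_space \<mu>)}"
proof -
  let ?S = "{\<mu> \<in> pseudonorms. \<not> finite_dim (X_space \<mu>) \<and> script_L_plus p lam (X_space \<mu>)}"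
  let ?U = "\<lambda>m. {\<mu> \<in> pseudonorms. approx_condition p lam m (extension \<mu>)}"
  have "\<not> finite_dim (X_space \<mu>) \<and> script_L_plus p lam (X_space \<mu>)
      \<longleftrightarrow> (\<forall>m. approx_condition p lam m (extension \<mu>))" if \<mu>: "\<mu> \<in> pseudonorms" for \<mu>
  proof -
    \<comment> \<open>Through \<open>T\<close>, conditions on the completion become conditions on
      the pseudonorm itself.\<close>
    obtain T where T: "linear T" "extension \<mu> = (\<lambda>x. norm (T x))" "X_space \<mu> = closure (range T)"
      using is_completion_X_space[OF \<mu>] unfolding is_completion_def by (metis ext)
    show ?thesis
      unfolding T(2,3) script_L_plus_def
      using approx_condition_if_script_L_plus[OF assms T(1)] script_L_if_approx_condition[OF assms _ T(1)]
        infinite_dim_if_approx_condition[OF assms(1) T(1)]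
      unfolding script_L_plus_def by blast
  qed
  then have eq: "?S = (\<Inter>m. ?U m)" by auto
  have gdelta: "gdelta_in (top_of_set pseudonorms) ?S"
    unfolding eq by (intro gdelta_in_Inter)
      (auto intro: open_imp_gdelta_in openin_approx_condition[OF assms(1)])
  have sub: "top_of_set pseudonorms_inf = subtopology (top_of_set pseudonorms) pseudonorms_inf"
    unfolding subtopology_subtopology by (rule arg_cong[of _ _ "subtopology _"]) (auto simp: pseudonorms_inf_def)
  \<comment> \<open>The set already lies in the subspace, so its trace there is the set
    itself.\<close>
  have "?S = ?S \<inter> pseudonorms_inf" by (auto simp: pseudonorms_inf_def)
  with gdelta have "gdelta_in (top_of_set pseudonorms_inf) ?S"
    unfolding sub gdelta_in_subtopology[of "top_of_set pseudonorms" pseudonorms_inf]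
    by (intro exI[of _ ?S] conjI)
  with gdelta show ?thesis by blast
qed

end
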